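(* For all $\tau\in\mathbb{H}$, writing $u=u(\tau)$, $$j(3\tau) = \dfrac{(1+4u^3)^3(1+6u+4u^3)^3(1-6u+36u^2+8u^3-24u^4+16u^6)^3}{u^3(1-2u)^6(1+u)^3(1-u+u^2)^3(1+2u+4u^2)^6},$$ $$j(6\tau) = \dfrac{(1-2u^3)^3(1+6u^2-2u^3)^3(1-6u^2-4u^3+36u^4+12u^5+4u^6)^3}{u^6(1-2u)^3(1+u)^6(1-u+u^2)^6(1+2u+4u^2)^3},$$ $$j(9\tau) = \dfrac{(1+4u^3)^3(1-12u^3+48u^6+64u^9)^3}{u^9(1-2u)^2(1+u)(1-u+u^2)(1+2u+4u^2)^2},$$ $$j(18\tau) = \dfrac{(1-2u^3)^3(1-6u^3-12u^6-8u^9)^3}{u^{18}(1-2u)(1+u)^2(1-u+u^2)^2(1+2u+4u^2)}.$$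
   Context: $\mathbb{H}$ is the complex upper half-plane, $q=e^{2\pi i\tau}$ and $q^r=e^{2\pi i r\tau}$ for rational $r$, $\eta(\tau)=q^{1/24}\prod_{n=1}^\infty(1-q^n)$ is the Dedekind eta function, and $$u(\tau):=\dfrac{\eta(3\tau)\eta^3(18\tau)}{\eta(6\tau)\eta^3(9\tau)}.$$ The modular $j$-invariant is $$j(\tau)=\eta^{-24}(\tau)\left(1+240\sum_{n=1}^\infty\dfrac{n^3q^n}{1-q^n}\right)^3.$$ *)

theory Defs
  imports "HOL-Analysis.Analysis"
begin

text \<open>
  The functions below are meant for arguments \<open>\<tau>\<close> in the upper half-plane, where the
  infinite product and series converge. Rational powers of \<open>q = exp (2\<pi>i\<tau>)\<close> are branch-free
  functions of \<open>\<tau>\<close>, namely \<open>exp (2\<pi>ir\<tau>)\<close>, rather than \<open>powr\<close> applied to \<open>q\<close>.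
\<close>

definition qpow :: "rat \<Rightarrow> complex \<Rightarrow> complex" where
  "qpow r \<tau> = exp (2 * of_real pi * \<i> * of_rat r * \<tau>)"

abbreviation nome :: "complex \<Rightarrow> complex" where
  "nome \<tau> \<equiv> qpow 1 \<tau>"

definition dedekind_eta :: "complex \<Rightarrow> complex" where
  "dedekind_eta \<tau> = qpow (1 / 24) \<tau> * (\<Prod>n. 1 - nome \<tau> ^ Suc n)"

definition modular_j :: "complex \<Rightarrow> complex" where
  "modular_j \<tau> = dedekind_eta \<tau> powi (-24) *
     (1 + 240 * (\<Sum>n. of_nat (Suc n) ^ 3 * nome \<tau> ^ Suc n / (1 - nome \<tau> ^ Suc n))) ^ 3"

definition eta_quotient_u :: "complex \<Rightarrow> complex" where
  "eta_quotient_u \<tau> =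
     (dedekind_eta (3 * \<tau>) * dedekind_eta (18 * \<tau>) ^ 3) /
     (dedekind_eta (6 * \<tau>) * dedekind_eta (9 * \<tau>) ^ 3)"

end

theory Submission
  imports Defs "HOL-Complex_Analysis.Complex_Analysis"
begin

text \<open>Put \<open>q = exp (2\<pi>i\<cdot>3\<tau>)\<close>, write \<open>P\<^sub>d = \<Prod>\<^sub>n (1 - q\<^bsup>dn\<^esup>)\<close>, and let \<open>w = u\<^sup>3\<close>. Then
  \<open>w = q (P\<^sub>1 P\<^sub>6\<^sup>3 / (P\<^sub>2 P\<^sub>3\<^sup>3))\<^sup>3\<close> is the standard Hauptmodul of \<open>\<Gamma>\<^sub>0(6)\<close> at \<open>3\<tau>\<close>, and
  \<open>(1 - 2u)(1 + 2u + 4u\<^sup>2) = 1 - 8w\<close>, \<open>(1 + u)(1 - u + u\<^sup>2) = 1 + w\<close> and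
  \<open>(1 + 6u + 4u\<^sup>3)(\<dots>) = (1 + 4w)\<^sup>3 + 216w\<close>, \<open>(1 + 6u\<^sup>2 - 2u\<^sup>3)(\<dots>) = (1 - 2w)\<^sup>3 + 216w\<^sup>2\<close>. So the four
  identities are the expressions of \<open>j\<close> at \<open>3\<tau>, 6\<tau>, 9\<tau>, 18\<tau>\<close> as rational functions of \<open>w\<close>. As
  \<open>j = E\<^sub>4\<^sup>3 / (q P\<^sub>1\<^bsup>24\<^esup>)\<close>, it is enough to express both \<open>E\<^sub>4(q\<^sup>d)\<close> and the discriminant for
  \<open>d = 1, 2, 3, 6\<close> through \<open>w\<close> and one form of weight 1, \<open>g = P\<^sub>3\<^sup>6 P\<^sub>2 / (P\<^sub>1\<^sup>2 P\<^sub>6\<^sup>3)\<close>.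

  No modular transformation is used. The argument has three sources.

  (1) An identity of elliptic functions, \<open>q_zeta_addition\<close>: for the multiplicative Weierstrass zeta
  function \<open>\<zeta>\<close> and theta function \<open>\<theta>\<close> of \<open>\<complex>\<^sup>* / q\<^bsup>\<int>\<^esup>\<close>, the sum \<open>\<zeta>(x) + \<zeta>(y) + \<zeta>(z) - \<zeta>(xyz) + 1\<close>
  is a quotient of values of \<open>\<theta>\<close>. Both sides have the same poles and residues as functions of
  \<open>z\<close>, so Liouville applies. At points of order 6 the theta values are quotients of the \<open>P\<^sub>d\<close> and the
  zeta values are combinations of \<open>a(q)\<close> and \<open>a(q\<^sup>2)\<close>, where \<open>a\<close> is the cubic theta function of the
  Borweins. Four choices of points (\<open>cubic_a_values\<close>) give \<open>a(q) = g (1 + 4w)\<close>,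
  \<open>a(q\<^sup>2) = g (1 - 2w)\<close> and eta quotients for \<open>1 - 8w\<close> and \<open>1 + w\<close> (\<open>level6_relations\<close>).

  (2) Ramanujan's differential equation \<open>12 q E\<^sub>2' = E\<^sub>2\<^sup>2 - E\<^sub>4\<close>, an elementary statement about double
  series (\<open>lambert_1_square\<close>).

  (3) A rigidity principle, \<open>square_functional_equation\<close>: a holomorphic function on the disc that
  vanishes at \<open>0\<close> and satisfies \<open>N(q) A(q) = N(q\<^sup>2) M(q)\<close> with \<open>A(0) \<noteq> 0\<close> is zero, because its
  order of vanishing would have to double.

  Logarithmic derivatives of the eta quotients \<open>w\<close>, \<open>1 - 8w\<close> and \<open>1 + w\<close> are combinations of
  \<open>E\<^sub>2(q\<^sup>d)\<close>; comparing them determines the differences of the \<open>d E\<^sub>2(q\<^sup>d)\<close> up to one common factor, and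
  (3) finds this factor: \<open>3E\<^sub>2(q\<^sup>3) - E\<^sub>2(q) = 2a(q)\<^sup>2\<close>. Differentiating once more with (2) gives
  \<open>E\<^sub>4(q) - 4E\<^sub>4(q\<^sup>2)\<close> as a polynomial in \<open>g\<close> and \<open>w\<close>. The function \<open>X = a (9a\<^sup>3 - 8b\<^sup>3)\<close> with
  \<open>b = P\<^sub>1\<^sup>3 / P\<^sub>3\<close> has the same value of \<open>X(q) - 4X(q\<^sup>2)\<close>, so (3) yields \<open>E\<^sub>4 = X\<close>
  (\<open>eisen4_level3\<close>), and the values of \<open>E\<^sub>4\<close> at \<open>q\<^sup>2, q\<^sup>3, q\<^sup>6\<close> follow (\<open>eisen4_level6\<close>).\<close>

section \<open>Infinite products and Lambert sums in an elliptic variable\<close>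

definition q_pochhammer :: "complex \<Rightarrow> complex \<Rightarrow> complex" where
  "q_pochhammer q z = (\<Prod>n. 1 - z * q ^ n)"

text \<open>Up to sign, the logarithmic derivative \<open>z d/dz\<close> of \<open>(z; q)\<^sub>\<infinity>\<close>.\<close>

definition q_lambert :: "complex \<Rightarrow> complex \<Rightarrow> complex" where
  "q_lambert q z = (\<Sum>n. z * q ^ n / (1 - z * q ^ n))"

text \<open>Jacobi's theta product without its Euler factor: it vanishes to first order exactly on
  the powers of \<open>q\<close>.\<close>

definition theta :: "complex \<Rightarrow> complex \<Rightarrow> complex" where
  "theta q z = q_pochhammer q z * q_pochhammer q (q / z)"

text \<open>Minus \<open>z d/dz log \<theta>(z)\<close>: the Weierstrass zeta function in the multiplicative variable,
  normalised so that \<open>\<zeta>(qz) = \<zeta>(z) + 1\<close> and \<open>\<zeta> + 1/2\<close> is odd under \<open>z \<mapsto> 1/z\<close>.\<close>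

definition q_zeta :: "complex \<Rightarrow> complex \<Rightarrow> complex" where
  "q_zeta q z = q_lambert q z - q_lambert q (q / z)"

lemma q_pochhammer_summable:
  assumes "norm q < 1"
  shows "summable (\<lambda>n. norm (1 - z * q ^ n - 1 :: complex))"
  using assms by (simp add: norm_mult norm_power summable_mult summable_geometric)

lemma q_pochhammer_convergent:
  assumes "norm q < 1"
  shows "convergent_prod (\<lambda>n. 1 - z * q ^ n :: complex)"
  using q_pochhammer_summable[OF assms, of z]
  by (intro abs_convergent_prod_imp_convergent_prod) (simp only: abs_convergent_prod_conv_summable)

lemma q_pochhammer_eq_0_iff:
  assumes "norm q < 1"
  shows "q_pochhammer q z = 0 \<longleftrightarrow> (\<exists>n. z * q ^ n = 1)"
proof -
  have "(\<lambda>n. 1 - z * q ^ n) has_prod q_pochhammer q z"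
    unfolding q_pochhammer_def using q_pochhammer_convergent[OF assms] by (simp add: convergent_prod_has_prod_iff)
  then have "q_pochhammer q z = 0 \<longleftrightarrow> 0 \<in> range (\<lambda>n. 1 - z * q ^ n)"
    by (rule has_prod_eq_0_iff)
  then show ?thesis by (auto simp: image_iff)
qed

lemma q_pochhammer_shift:
  assumes "norm q < 1"
  shows "q_pochhammer q z = (1 - z) * q_pochhammer q (q * z)"
proof -
  have "(\<lambda>n. 1 - z * q ^ n) has_prod ((\<Prod>k<1. 1 - z * q ^ k) * (\<Prod>k. 1 - z * q ^ (k + 1)))"
    by (rule has_prod_ignore_initial_segment'[OF q_pochhammer_convergent[OF assms]])
  then show ?thesis unfolding q_pochhammer_def
    by (simp add: has_prod_iff mult_ac)
qed

lemma q_pochhammer_0 [simp]: "q_pochhammer q 0 = 1"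
  by (simp add: q_pochhammer_def)

lemma q_pochhammer_uniform_limit:
  assumes "norm q < 1" "compact K"
  shows "uniform_limit K (\<lambda>N z. \<Prod>n<N. 1 - z * q ^ n) (q_pochhammer q) sequentially"
proof -
  obtain B where B: "\<And>z. z \<in> K \<Longrightarrow> norm z \<le> B"
    using compact_imp_bounded[OF assms(2)] by (auto simp: bounded_iff)
  have "uniformly_convergent_on K (\<lambda>N z. \<Sum>n<N. norm (1 - z * q ^ n - 1))"
  proof (rule Weierstrass_m_test')
    show "norm (norm (1 - z * q ^ n - 1)) \<le> B * norm q ^ n" if "z \<in> K" for z n
      using B[OF that] by (simp add: norm_mult norm_power mult_right_mono)
    show "summable (\<lambda>n. B * norm q ^ n)"
      using assms by (simp add: summable_mult summable_geometric)
  qed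
  then have "uniformly_convergent_on K (\<lambda>N z. \<Prod>n<N. 1 - z * q ^ n)"
    by (intro uniformly_convergent_on_prod' assms continuous_intros)
  then have *: "uniform_limit K (\<lambda>N z. \<Prod>n<N. 1 - z * q ^ n) (\<lambda>z. lim (\<lambda>N. \<Prod>n<N. 1 - z * q ^ n)) sequentially"
    by (simp add: uniformly_convergent_uniform_limit_iff)
  have "lim (\<lambda>N. \<Prod>n<N. 1 - z * q ^ n) = q_pochhammer q z" for z
    unfolding q_pochhammer_def
    by (metis limI convergent_prod_has_prod has_prod_imp_tendsto' q_pochhammer_convergent[OF assms(1)])
  with * show ?thesis by simp
qed

lemma q_pochhammer_holomorphic:
  assumes "norm q < 1"
  shows "q_pochhammer q holomorphic_on UNIV"
proof (rule holomorphic_uniform_sequence)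
  show "(\<lambda>z. \<Prod>n<N. 1 - z * q ^ n) holomorphic_on UNIV" for N
    by (intro holomorphic_intros)
  show "\<exists>d>0. cball x d \<subseteq> UNIV \<and> uniform_limit (cball x d) (\<lambda>N z. \<Prod>n<N. 1 - z * q ^ n) (q_pochhammer q) sequentially" for x
    using q_pochhammer_uniform_limit[OF assms, of "cball x 1"] by (intro exI[of _ 1]) auto
qed auto

lemma q_pochhammer_analytic:
  assumes "norm q < 1" "f analytic_on S"
  shows "(\<lambda>z. q_pochhammer q (f z)) analytic_on S"
  using analytic_on_compose_gen[OF assms(2), of "q_pochhammer q" UNIV] q_pochhammer_holomorphic[OF assms(1)]
  by (auto simp: analytic_on_open o_def)

lemma q_lambert_term_bound:
  fixes q z :: complex
  assumes "norm q < 1" "norm z \<le> r" "r < 1"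
  shows "norm (z * q ^ n / (1 - z * q ^ n)) \<le> r / (1 - r) * norm q ^ n"
proof -
  have r: "0 \<le> r" using assms norm_ge_zero order_trans by blast
  have "norm (z * q ^ n) \<le> r * norm q ^ n"
    using assms by (simp add: norm_mult norm_power mult_right_mono)
  also have "\<dots> \<le> r"
    using assms r by (simp add: mult_left_le power_le_one)
  finally have "norm (z * q ^ n) \<le> r" .
  then have 1: "1 - r \<le> norm (1 - z * q ^ n)"
    using norm_triangle_ineq2[of 1 "z * q ^ n"] by simp
  have "norm (z * q ^ n / (1 - z * q ^ n)) \<le> (r * norm q ^ n) / (1 - r)"
    unfolding norm_divide using assms 1 r
    by (intro frac_le) (auto simp: norm_mult norm_power mult_right_mono)
  then show ?thesis by simp
qed

text \<open>Near the origin the series converges uniformly; everywhere else \<open>q_lambert\<close> is understood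
  through its functional equation, which moves a point into the unit disc at the price of finitely
  many rational terms.\<close>

lemma q_lambert_holomorphic_ball:
  assumes "norm q < 1"
  shows "q_lambert q holomorphic_on ball 0 1"
proof (rule holomorphic_uniform_sequence)
  have nz: "1 - z * q ^ n \<noteq> 0" if "norm z < 1" for z n
  proof
    assume "1 - z * q ^ n = 0"
    then have "norm (z * q ^ n) = 1" by (metis diff_eq_diff_eq diff_zero norm_one)
    moreover have "norm (z * q ^ n) \<le> norm z * 1"
      unfolding norm_mult norm_power by (intro mult_left_mono power_le_one) (use assms in auto)
    ultimately show False using that by simp
  qed
  show "(\<lambda>z. \<Sum>n<N. z * q ^ n / (1 - z * q ^ n)) holomorphic_on ball 0 1" for N
    using nz by (intro holomorphic_intros) auto
  fix x :: complex assume x: "x \<in> ball 0 1"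
  define d where "d = (1 - norm x) / 2"
  have d: "d > 0" "d + norm x < 1" using x by (auto simp: d_def field_simps)
  have le: "norm y \<le> d + norm x" if "y \<in> cball x d" for y
    using that norm_triangle_ineq2[of y x] by (simp add: dist_norm norm_minus_commute)
  have sub: "cball x d \<subseteq> ball 0 1"
    using le d by force
  have "uniform_limit (cball x d) (\<lambda>N z. \<Sum>n<N. z * q ^ n / (1 - z * q ^ n)) (q_lambert q) sequentially"
    unfolding q_lambert_def
  proof (rule Weierstrass_m_test)
    show "norm (z * q ^ n / (1 - z * q ^ n)) \<le> (d + norm x) / (1 - (d + norm x)) * norm q ^ n"
      if "z \<in> cball x d" for n z
      by (rule q_lambert_term_bound[OF assms le[OF that] d(2)])
    show "summable (\<lambda>n. (d + norm x) / (1 - (d + norm x)) * norm q ^ n)"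
      using assms by (intro summable_mult summable_geometric) auto
  qed
  then show "\<exists>d>0. cball x d \<subseteq> ball 0 1 \<and> uniform_limit (cball x d) (\<lambda>N z. \<Sum>n<N. z * q ^ n / (1 - z * q ^ n)) (q_lambert q) sequentially"
    using d sub by blast
qed auto

lemma scale_into_unit_disc:
  fixes q z :: complex
  assumes "norm q < 1"
  obtains N where "norm (z * q ^ N) < 1"
proof -
  have "(\<lambda>n. z * q ^ n) \<longlonglongrightarrow> z * 0"
    by (intro tendsto_intros LIMSEQ_power_zero assms)
  then have "eventually (\<lambda>n. norm (z * q ^ n) < 1) sequentially"
    using tendstoD[of "\<lambda>n. z * q ^ n" 0 sequentially 1] by simp
  then show ?thesis using that by (auto simp: eventually_sequentially)
qed

lemma q_lambert_summable:
  assumes "norm q < 1"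
  shows "summable (\<lambda>n. z * q ^ n / (1 - z * q ^ n) :: complex)"
proof -
  obtain N where N: "norm (z * q ^ N) < 1" using scale_into_unit_disc[OF assms] .
  have "summable (\<lambda>n. z * q ^ N * q ^ n / (1 - z * q ^ N * q ^ n))"
    by (rule summable_comparison_test'[of "\<lambda>n. norm (z * q ^ N) / (1 - norm (z * q ^ N)) * norm q ^ n" 0])
       (use assms N q_lambert_term_bound[OF assms order_refl N] in \<open>auto intro!: summable_mult summable_geometric\<close>)
  then have "summable (\<lambda>n. z * q ^ (n + N) / (1 - z * q ^ (n + N)))"
    by (simp add: power_add mult_ac)
  then show ?thesis by (subst (asm) summable_iff_shift)
qed

lemma q_lambert_shift:
  assumes "norm q < 1"
  shows "q_lambert q z = z / (1 - z) + q_lambert q (q * z)"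
  using suminf_split_head[OF q_lambert_summable[OF assms, of z]]
  unfolding q_lambert_def by (simp add: mult_ac)

lemma q_lambert_analytic_aux:
  assumes q: "norm q < 1" and "norm (z * q ^ N) < 1" "\<And>n. z * q ^ n \<noteq> 1"
  shows "q_lambert q analytic_on {z}"
  using assms(2,3)
proof (induction N arbitrary: z)
  case 0
  then show ?case
    using q_lambert_holomorphic_ball[OF q] by (auto simp: analytic_at intro!: exI[of _ "ball 0 1"])
next
  case (Suc N)
  have "q_lambert q analytic_on {q * z}"
  proof (rule Suc.IH)
    show "norm (q * z * q ^ N) < 1" using Suc.prems(1) by (simp add: mult_ac)
    show "q * z * q ^ n \<noteq> 1" for n using Suc.prems(2)[of "Suc n"] by (simp add: mult_ac)
  qed
  then have "(q_lambert q \<circ> (\<lambda>z. q * z)) analytic_on {z}"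
    by (intro analytic_on_compose analytic_intros) auto
  then have "(\<lambda>z. z / (1 - z) + q_lambert q (q * z)) analytic_on {z}"
    using Suc.prems(2)[of 0] by (intro analytic_intros) (auto simp: o_def)
  moreover have "(\<lambda>z. z / (1 - z) + q_lambert q (q * z)) = q_lambert q"
    by (intro ext) (rule q_lambert_shift[OF q, symmetric])
  ultimately show ?case by simp
qed

lemma q_lambert_analytic_at:
  assumes q: "norm q < 1" and "q_pochhammer q z \<noteq> 0"
  shows "q_lambert q analytic_on {z}"
proof -
  obtain N where N: "norm (z * q ^ N) < 1" using scale_into_unit_disc[OF q] .
  then show ?thesis
    using q_lambert_analytic_aux[OF q N] assms by (auto simp: q_pochhammer_eq_0_iff)
qed

lemma q_lambert_analytic:
  assumes q: "norm q < 1" and "f analytic_on {z}" "q_pochhammer q (f z) \<noteq> 0"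
  shows "(\<lambda>z. q_lambert q (f z)) analytic_on {z}"
  using analytic_on_compose[OF assms(2), of "q_lambert q"] q_lambert_analytic_at[OF q assms(3)] by (simp add: o_def)

lemma q_lambert_meromorphic_aux:
  assumes q: "norm q < 1" and "norm (z * q ^ N) < 1"
  shows "q_lambert q meromorphic_on {z}"
  using assms(2)
proof (induction N arbitrary: z)
  case 0
  then have "q_lambert q analytic_on {z}"
    using q_lambert_holomorphic_ball[OF q] by (auto simp: analytic_at intro!: exI[of _ "ball 0 1"])
  then show ?case by (rule analytic_on_imp_meromorphic_on)
next
  case (Suc N)
  have m: "q_lambert q meromorphic_on {q * z}"
    by (rule Suc.IH) (use Suc.prems in \<open>simp add: mult_ac\<close>)
  have "(\<lambda>z. q_lambert q (q * z)) meromorphic_on {z}"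
    by (rule meromorphic_on_compose[OF m]) (auto intro!: analytic_intros)
  then have "(\<lambda>z. z / (1 - z) + q_lambert q (q * z)) meromorphic_on {z}"
    by (intro meromorphic_intros)
  moreover have "(\<lambda>z. z / (1 - z) + q_lambert q (q * z)) = q_lambert q"
    by (intro ext) (rule q_lambert_shift[OF q, symmetric])
  ultimately show ?case by simp
qed

lemma q_lambert_meromorphic:
  assumes q: "norm q < 1" and f: "f analytic_on {z}"
  shows "(\<lambda>z. q_lambert q (f z)) meromorphic_on {z}"
proof -
  obtain N where N: "norm (f z * q ^ N) < 1" using scale_into_unit_disc[OF q] .
  show ?thesis
    by (rule meromorphic_on_compose[OF q_lambert_meromorphic_aux[OF q N] f]) auto
qed

section \<open>Theta and zeta functions of the multiplicative torus\<close>

lemma q_pochhammer_nonzero_small: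
  assumes "norm q < 1" "norm z < 1"
  shows "q_pochhammer q z \<noteq> 0"
proof -
  have "norm (z * q ^ n) < 1" for n
  proof -
    have "norm (z * q ^ n) \<le> norm z * 1"
      unfolding norm_mult norm_power by (intro mult_left_mono power_le_one) (use assms in auto)
    then show ?thesis using assms(2) by simp
  qed
  then show ?thesis using q_pochhammer_eq_0_iff[OF assms(1)] by (metis less_irrefl norm_one)
qed

lemma theta_qshift:
  assumes "norm q < 1" "q \<noteq> 0" "z \<noteq> 0"
  shows "theta q (q * z) = - theta q z / z"
proof (cases "z = 1")
  case True
  then show ?thesis using assms q_pochhammer_shift[of q 1] by (simp add: theta_def)
next
  case False
  have "theta q (q * z) = q_pochhammer q (q * z) * q_pochhammer q (1 / z)"
    using assms by (simp add: theta_def)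
  also have "q_pochhammer q (1 / z) = (1 - 1 / z) * q_pochhammer q (q / z)"
    using q_pochhammer_shift[OF assms(1), of "1 / z"] by simp
  also have "q_pochhammer q (q * z) = q_pochhammer q z / (1 - z)"
    using q_pochhammer_shift[OF assms(1), of z] False by simp
  also have "q_pochhammer q z / (1 - z) * ((1 - 1 / z) * q_pochhammer q (q / z)) = - theta q z / z"
    using False assms by (simp add: theta_def field_simps)
  finally show ?thesis .
qed

lemma theta_inverse:
  assumes "norm q < 1" "z \<noteq> 0"
  shows "theta q (1 / z) = - theta q z / z"
proof -
  have "theta q (1 / z) = (1 - 1 / z) * q_pochhammer q (q / z) * q_pochhammer q (q * z)"
    using q_pochhammer_shift[OF assms(1), of "1 / z"] by (simp add: theta_def)
  also have "\<dots> = - ((1 - z) * q_pochhammer q (q * z) * q_pochhammer q (q / z)) / z"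
    using assms by (simp add: field_simps)
  also have "(1 - z) * q_pochhammer q (q * z) * q_pochhammer q (q / z) = theta q z"
    using q_pochhammer_shift[OF assms(1), of z] by (simp add: theta_def)
  finally show ?thesis .
qed

lemma theta_eq_0_iff:
  assumes "norm q < 1" "q \<noteq> 0" "z \<noteq> 0"
  shows "theta q z = 0 \<longleftrightarrow> (\<exists>k. z = q powi k)"
proof
  assume "theta q z = 0"
  then consider n where "z * q ^ n = 1" | n where "(q / z) * q ^ n = 1"
    using q_pochhammer_eq_0_iff[OF assms(1)] by (auto simp: theta_def)
  then show "\<exists>k. z = q powi k"
  proof cases
    case 1
    then have "z = q powi (- int n)" using assms by (simp add: power_int_minus field_simps)
    then show ?thesis by blast
  next
    case 2
    then have "z = q ^ Suc n" using assms by (simp add: field_simps)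
    then have "z = q powi (int (Suc n))" by (simp only: power_int_of_nat)
    then show ?thesis by blast
  qed
next
  assume "\<exists>k. z = q powi k"
  then obtain k where k: "z = q powi k" by blast
  show "theta q z = 0"
  proof (cases "k \<ge> 0")
    case False
    then have "z * q ^ nat (-k) = 1"
      using assms k by (simp add: power_int_def field_simps)
    then show ?thesis using q_pochhammer_eq_0_iff[OF assms(1)] by (auto simp: theta_def)
  next
    case True
    show ?thesis
    proof (cases "k = 0")
      case True
      then have "z * q ^ 0 = 1" using k by simp
      then show ?thesis using q_pochhammer_eq_0_iff[OF assms(1)] by (metis mult_eq_0_iff theta_def)
    next
      case False
      then have "(q / z) * q ^ (nat k - 1) = 1"
        using True assms k by (simp add: power_int_def field_simps flip: power_Suc)
      then show ?thesis using q_pochhammer_eq_0_iff[OF assms(1)] by (metis mult_eq_0_iff theta_def)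
    qed
  qed
qed

lemma q_zeta_qshift:
  assumes "norm q < 1" "q \<noteq> 0" "z \<noteq> 0" "z \<noteq> 1"
  shows "q_zeta q (q * z) = q_zeta q z + 1"
proof -
  have "q_zeta q (q * z) = q_lambert q (q * z) - q_lambert q (1 / z)"
    using assms by (simp add: q_zeta_def)
  also have "q_lambert q (1 / z) = 1 / (z - 1) + q_lambert q (q / z)"
    using q_lambert_shift[OF assms(1), of "1 / z"] assms by (simp add: field_simps)
  also have "q_lambert q (q * z) = q_lambert q z - z / (1 - z)"
    using q_lambert_shift[OF assms(1), of z] by simp
  also have "q_lambert q z - z / (1 - z) - (1 / (z - 1) + q_lambert q (q / z)) = q_zeta q z + 1"
    using assms by (simp add: q_zeta_def divide_simps) (simp add: algebra_simps)
  finally show ?thesis .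
qed

lemma q_zeta_inverse:
  assumes "norm q < 1" "z \<noteq> 0" "z \<noteq> 1"
  shows "q_zeta q (1 / z) = - q_zeta q z - 1"
proof -
  have "q_lambert q (1 / z) = 1 / (z - 1) + q_lambert q (q / z)"
    using q_lambert_shift[OF assms(1), of "1 / z"] assms by (simp add: field_simps)
  moreover have "q_lambert q z = z / (1 - z) + q_lambert q (q * z)"
    using q_lambert_shift[OF assms(1), of z] by simp
  moreover have "1 / (z - 1) = - z / (1 - z) - 1" using assms by (simp add: divide_simps)
  ultimately show ?thesis by (simp add: q_zeta_def)
qed

lemma theta_analytic:
  assumes "norm q < 1" "f analytic_on {z}" "f z \<noteq> 0"
  shows "(\<lambda>z. theta q (f z)) analytic_on {z}"
  unfolding theta_def using assms by (intro analytic_intros q_pochhammer_analytic) auto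

lemma q_zeta_analytic:
  assumes "norm q < 1" "f analytic_on {z}" "f z \<noteq> 0" "theta q (f z) \<noteq> 0"
  shows "(\<lambda>z. q_zeta q (f z)) analytic_on {z}"
  unfolding q_zeta_def using assms by (intro analytic_intros q_lambert_analytic) (auto simp: theta_def)

lemma q_zeta_meromorphic:
  assumes "norm q < 1" "f analytic_on {z}" "f z \<noteq> 0"
  shows "(\<lambda>z. q_zeta q (f z)) meromorphic_on {z}"
  unfolding q_zeta_def using assms by (intro meromorphic_intros q_lambert_meromorphic analytic_intros) auto

section \<open>Liouville's theorem on the multiplicative torus\<close>

lemma powi_shift_invariant:
  fixes q :: complex
  assumes "q \<noteq> 0" "\<And>z. z \<noteq> 0 \<Longrightarrow> P (q * z) \<longleftrightarrow> P z" "z \<noteq> 0"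
  shows "P (q powi k * z) \<longleftrightarrow> P z"
proof -
  have *: "P (q ^ n * z) \<longleftrightarrow> P z" if "z \<noteq> 0" for n z
  proof (induction n)
    case (Suc n)
    then show ?case using assms(2)[of "q ^ n * z"] that assms(1) by (simp add: mult_ac)
  qed auto
  show ?thesis
  proof (cases "k \<ge> 0")
    case True
    then show ?thesis using *[OF assms(3), of "nat k"] by (simp add: power_int_def)
  next
    case False
    then show ?thesis using *[of "q powi k * z" "nat (-k)"] assms(1,3)
      by (simp add: power_int_def field_simps)
  qed
qed

lemma filtermap_times_at:
  fixes a :: complex
  assumes "a \<noteq> 0"
  shows "filtermap ((*) a) (at z) = at (a * z)"
  by (rule filtermap_nhds_eq_imp_filtermap_at_eq[OF filtermap_nhds_times[OF assms]])
     (use assms in \<open>auto intro!: always_eventually\<close>)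

lemma is_pole_times:
  fixes a :: complex
  assumes "a \<noteq> 0"
  shows "is_pole f (a * z) \<longleftrightarrow> is_pole (\<lambda>w. f (a * w)) z"
  unfolding is_pole_def filterlim_def filtermap_times_at[OF assms, symmetric]
  by (simp add: filtermap_filtermap)

text \<open>Liouville's theorem for \<open>\<complex>\<^sup>* / q\<^bsup>\<int>\<^esup>\<close>: after the singularities are removed, the
  function is determined by its values on the compact annulus \<open>|q| \<le> |z| \<le> 1\<close>, so its pullback
  under \<open>exp\<close> is a bounded entire function. The points of analyticity in the conclusion are those where
  the given function agrees with its extension.\<close>

lemma multiplicative_elliptic_constant:
  fixes h :: "complex \<Rightarrow> complex"
  assumes q: "norm q < 1" "q \<noteq> 0"
    and mero: "h meromorphic_on (- {0})"
    and per: "\<And>z. z \<noteq> 0 \<Longrightarrow> eventually (\<lambda>w. h (q * w) = h w) (at z)"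
    and nopole: "\<And>z. z \<noteq> 0 \<Longrightarrow> \<not> is_pole h z"
  obtains c where "\<And>z. z \<noteq> 0 \<Longrightarrow> h analytic_on {z} \<Longrightarrow> h z = c"
proof -
  define H where "H = remove_sings h"
  have ana: "H analytic_on {z}" if "z \<noteq> 0" for z
  proof (rule nicely_meromorphic_on_imp_analytic_at)
    show "H nicely_meromorphic_on (-{0})" unfolding H_def by (rule remove_sings_nicely_meromorphic[OF mero])
    show "z \<in> - {0}" using that by simp
    have "isolated_singularity_at h z"
      using meromorphic_on_isolated_singularity[OF meromorphic_on_subset[OF mero]] that by auto
    then show "\<not> is_pole H z" unfolding H_def using nopole[OF that] by simp
  qed
  have shift: "H (q * z) = H z" if "z \<noteq> 0" for z
  proof -
    have "H (q * z) = remove_sings (h \<circ> (*) q) z"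
      unfolding H_def by (rule remove_sings_compose[OF filtermap_times_at[OF q(2)], symmetric])
    also have "\<dots> = H z" unfolding H_def
      by (rule remove_sings_cong) (use per[OF that] in \<open>auto simp: o_def\<close>)
    finally show ?thesis .
  qed
  have cont: "continuous_on (cball 0 1 - ball 0 (norm q)) H"
  proof -
    have "H analytic_on (cball 0 1 - ball 0 (norm q))"
      unfolding analytic_on_analytic_at[of H "cball 0 1 - ball 0 (norm q)"]
      by (intro ballI ana) (use q in auto)
    then show ?thesis by (intro holomorphic_on_imp_continuous_on analytic_imp_holomorphic)
  qed
  then have "compact (H ` (cball 0 1 - ball 0 (norm q)))"
    by (intro compact_continuous_image compact_diff) auto
  then have "bounded (H ` (cball 0 1 - ball 0 (norm q)))" by (rule compact_imp_bounded)
  then obtain B where B: "\<And>z. z \<in> cball 0 1 - ball 0 (norm q) \<Longrightarrow> norm (H z) \<le> B"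
    unfolding bounded_iff by blast
  have bound: "norm (H z) \<le> B" if z: "z \<noteq> 0" for z
  proof -
    \<comment> \<open>The power of \<open>q\<close> that moves \<open>z\<close> into the annulus \<open>|q| \<le> |y| \<le> 1\<close>.\<close>
    define k where "k = \<lfloor>- ln (norm z) / ln (norm q)\<rfloor>"
    have lq: "ln (norm q) < 0" using q by simp
    have kk: "of_int k \<le> - ln (norm z) / ln (norm q)" "- ln (norm z) / ln (norm q) < of_int k + 1"
      unfolding k_def by linarith+
    have lnp: "ln (norm q powi j) = of_int j * ln (norm q)" for j
      using q by (auto simp: power_int_def ln_realpow ln_inverse)
    define y where "y = q powi (k + 1) * z"
    have y0: "norm y > 0" using z q by (simp add: y_def norm_mult norm_power_int)
    have lny: "ln (norm y) = (of_int k + 1) * ln (norm q) + ln (norm z)"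
      using z q by (simp add: y_def norm_mult norm_power_int ln_mult lnp)
    have "(of_int k + 1) * ln (norm q) \<le> (- ln (norm z) / ln (norm q)) * ln (norm q)"
      using kk(2) lq by (intro mult_right_mono_neg) auto
    then have "ln (norm y) \<le> 0" using lny lq by simp
    then have y1: "norm y \<le> 1" using y0 by simp
    have "of_int k * ln (norm q) \<ge> (- ln (norm z) / ln (norm q)) * ln (norm q)"
      using kk(1) lq by (intro mult_right_mono_neg) auto
    then have "ln (norm q) \<le> ln (norm y)" using lny lq by (simp add: algebra_simps)
    then have "norm q \<le> norm y" using y0 q by simp
    with y1 have "norm (H y) \<le> B" by (intro B) auto
    moreover have "norm (H (q powi (k+1) * z)) \<le> B \<longleftrightarrow> norm (H z) \<le> B"
      by (rule powi_shift_invariant[where P = "\<lambda>z. norm (H z) \<le> B"]) (use q z shift in auto)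
    ultimately show ?thesis by (simp add: y_def)
  qed
  have "(H \<circ> exp) holomorphic_on UNIV"
  proof -
    have "(H \<circ> exp) analytic_on {w}" for w
      by (rule analytic_on_compose) (auto intro!: analytic_intros ana)
    then show ?thesis using analytic_imp_holomorphic analytic_on_analytic_at by blast
  qed
  moreover have "bounded (range (H \<circ> exp))"
    using bound by (auto simp: bounded_iff intro!: exI[of _ B])
  ultimately have "(H \<circ> exp) constant_on UNIV" by (rule Liouville_theorem)
  then obtain c where c: "\<And>w. H (exp w) = c" by (auto simp: constant_on_def)
  have "h z = c" if "z \<noteq> 0" "h analytic_on {z}" for z
    using c[of "ln z"] that by (simp add: H_def)
  then show ?thesis using that by blast
qed

section \<open>The addition formula for four zeta values\<close>

lemma removable_at_simple_zero:
  fixes F :: "complex \<Rightarrow> complex"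
  assumes "F analytic_on {p}" "F p = 0"
  obtains c where "((\<lambda>z. F z / (z - p)) \<longlongrightarrow> c) (at p)"
proof -
  have "(F has_field_derivative deriv F p) (at p)"
    using assms(1) analytic_derivI by blast
  then show ?thesis using that[of "deriv F p"] assms(2) by (simp add: has_field_derivative_iff)
qed

lemma not_pole_if_limit:
  fixes f :: "complex \<Rightarrow> complex"
  assumes "(f \<longlongrightarrow> c) (at p)"
  shows "\<not> is_pole f p"
  using assms not_tendsto_and_filterlim_at_infinity[of "at p" f c] by (auto simp: is_pole_def)

lemma q_zeta_pole_part:
  assumes "norm q < 1"
  shows "q_zeta q z = z / (1 - z) + (q_lambert q (q * z) - q_lambert q (q / z))"
  using q_lambert_shift[OF assms, of z] by (simp add: q_zeta_def)

lemma theta_zero_part: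
  assumes "norm q < 1"
  shows "theta q z = (1 - z) * (q_pochhammer q (q * z) * q_pochhammer q (q / z))"
  using q_pochhammer_shift[OF assms, of z] by (simp add: theta_def)

text \<open>As functions of \<open>z\<close>, both sides are invariant under \<open>z \<mapsto> qz\<close> and have at most simple
  poles, at the classes of \<open>1\<close> and \<open>1/(xy)\<close>. The constant \<open>(q; q)\<^sub>\<infinity>\<^sup>2\<close> makes the residues agree, so the
  difference is constant, and it vanishes at \<open>z = 1/y\<close>, where \<open>\<theta>(yz) = \<theta>(1) = 0\<close> and the zeta values
  cancel by oddness. In additive notation this is the classical formula for
  \<open>\<zeta>(x) + \<zeta>(y) + \<zeta>(z) - \<zeta>(x + y + z)\<close> as a quotient of sigma functions.\<close>

theorem q_zeta_addition:
  assumes q: "norm q < 1" "q \<noteq> 0"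
    and nz: "x \<noteq> 0" "y \<noteq> 0" "z \<noteq> 0"
    and th: "theta q x \<noteq> 0" "theta q y \<noteq> 0" "theta q z \<noteq> 0" "theta q (x * y) \<noteq> 0" "theta q (x * y * z) \<noteq> 0"
  shows "q_zeta q x + q_zeta q y + q_zeta q z - q_zeta q (x * y * z) + 1 =
     q_pochhammer q q ^ 2 * theta q (x * y) * theta q (y * z) * theta q (x * z) /
       (theta q x * theta q y * theta q z * theta q (x * y * z))"
proof -
  define C where "C = q_zeta q x + q_zeta q y + 1"
  define K where "K = q_pochhammer q q ^ 2 * theta q (x * y) / (theta q x * theta q y)"
  define R where "R = (\<lambda>z. K * theta q (y * z) * theta q (x * z) / (theta q z * theta q (x * y * z)))"
  define h where "h = (\<lambda>z. C + (q_zeta q z - q_zeta q (x * y * z)) - R z)"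
  have qq: "q_pochhammer q q \<noteq> 0" using q_pochhammer_nonzero_small[OF q(1) q(1)] .
  have mero: "h meromorphic_on (- {0})"
    unfolding h_def R_def
    by (subst meromorphic_on_meromorphic_at, intro ballI meromorphic_intros q_zeta_meromorphic q
          analytic_on_imp_meromorphic_on[OF theta_analytic] analytic_intros) (use q nz in auto)
  have ana: "h analytic_on {z}" if "z \<noteq> 0" "theta q z \<noteq> 0" "theta q (x * y * z) \<noteq> 0" for z
    unfolding h_def R_def
    by (intro analytic_intros q_zeta_analytic theta_analytic q) (use that nz in auto)
  have thper: "theta q (a * (q * z)) = - theta q (a * z) / (a * z)" if "a \<noteq> 0" "z \<noteq> 0" for a z
    using theta_qshift[OF q, of "a * z"] that by (simp add: mult_ac)
  have xy: "x * y \<noteq> 0" using nz by simp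
  have hper: "h (q * z) = h z" if "z \<noteq> 0" "z \<noteq> 1" "x * y * z \<noteq> 1" for z
  proof -
    have "R (q * z) = R z"
      unfolding R_def thper[OF nz(2) that(1)] thper[OF nz(1) that(1)] theta_qshift[OF q that(1)]
        thper[OF xy that(1)] using that nz by (simp add: divide_simps)
    moreover have "q_zeta q (q * z) = q_zeta q z + 1" by (rule q_zeta_qshift) (use q that in auto)
    moreover have "q_zeta q (x * y * (q * z)) = q_zeta q (x * y * z) + 1"
      using q_zeta_qshift[OF q, of "x * y * z"] nz that by (simp add: mult_ac)
    ultimately show ?thesis by (simp add: h_def)
  qed
  have per: "eventually (\<lambda>w. h (q * w) = h w) (at z)" if "z \<noteq> 0" for z
  proof -
    have "eventually (\<lambda>w. w \<noteq> 0 \<and> w \<noteq> 1 \<and> w \<noteq> 1 / (x * y)) (at z)"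
      by (intro eventually_conj eventually_neq_at_within)
    then show ?thesis
    proof eventually_elim
      case (elim w)
      then have "x * y * w \<noteq> 1" using nz by (auto simp: field_simps)
      with elim show ?case by (intro hper) auto
    qed
  qed
  have pole_per: "is_pole h (q * z) \<longleftrightarrow> is_pole h z" if "z \<noteq> 0" for z
    unfolding is_pole_times[OF q(2)] by (rule is_pole_cong[OF per[OF that] refl])
  \<comment> \<open>Near \<open>1\<close> both \<open>\<zeta>(z)\<close> and the quotient \<open>R\<close> behave like \<open>1/(1 - z)\<close>.\<close>
  have pole1: "\<not> is_pole h 1"
  proof -
    define g where "g = (\<lambda>z. K * theta q (y * z) * theta q (x * z) / ((q_pochhammer q (q * z) * q_pochhammer q (q / z)) * theta q (x * y * z)))"
    have g_ana: "g analytic_on {1}" unfolding g_def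
      by (intro analytic_intros theta_analytic q_pochhammer_analytic q) (use nz th qq in auto)
    have g1: "g 1 = 1"
      using th qq by (simp add: g_def K_def power2_eq_square)
    obtain c where c: "((\<lambda>z. (g z - z) / (z - 1)) \<longlongrightarrow> c) (at 1)"
      by (rule removable_at_simple_zero[of "\<lambda>z. g z - z" 1]) (use g_ana g1 in \<open>auto intro!: analytic_intros\<close>)
    define B where "B = (\<lambda>z. C + (q_lambert q (q * z) - q_lambert q (q / z)) - q_zeta q (x * y * z))"
    have "B analytic_on {1}" unfolding B_def
      by (intro analytic_intros q_lambert_analytic q_zeta_analytic q) (use nz th qq in auto)
    then have "(B \<longlongrightarrow> B 1) (at 1)"
      using analytic_at_imp_isCont isCont_def by blast
    then have "((\<lambda>z. B z + (g z - z) / (z - 1)) \<longlongrightarrow> B 1 + c) (at 1)"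
      using c by (intro tendsto_intros)
    moreover have "B z + (g z - z) / (z - 1) = h z" if "z \<noteq> 1" for z
    proof -
      have "R z = g z / (1 - z)"
        unfolding R_def g_def theta_zero_part[OF q(1), of z] by simp
      moreover have "z / (1 - z) - g z / (1 - z) = (g z - z) / (z - 1)"
        using that by (simp add: divide_simps) (simp add: algebra_simps)
      ultimately show ?thesis
        unfolding h_def B_def q_zeta_pole_part[OF q(1), of z] by (simp add: algebra_simps)
    qed
    then have "eventually (\<lambda>z. B z + (g z - z) / (z - 1) = h z) (at 1)"
      by (auto simp: eventually_at_filter)
    ultimately have "(h \<longlongrightarrow> B 1 + c) (at 1)" by (rule Lim_transform_eventually)
    then show ?thesis by (rule not_pole_if_limit)
  qed
  \<comment> \<open>The second class of poles, where \<open>xyz\<close> passes through \<open>1\<close> and the residues are opposite.\<close>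
  define p where "p = 1 / (x * y)"
  have p: "p \<noteq> 0" "x * y * p = 1" using nz by (auto simp: p_def)
  have thp: "theta q p \<noteq> 0"
    using theta_inverse[OF q(1), of "x * y"] nz th by (simp add: p_def)
  have pole2: "\<not> is_pole h p"
  proof -
    define v where "v = (\<lambda>z. x * y * z)"
    define g where "g = (\<lambda>z. K * theta q (y * z) * theta q (x * z) / (theta q z * (q_pochhammer q (q * v z) * q_pochhammer q (q / v z))))"
    have v: "v analytic_on {p}" "v p = 1" using p by (auto simp: v_def intro!: analytic_intros)
    have g_ana: "g analytic_on {p}" unfolding g_def
      by (intro analytic_intros theta_analytic q_pochhammer_analytic q v) (use nz p thp qq v in auto)
    have g1: "g p = - 1"
    proof -
      have t1: "theta q (y * p) = - theta q x / x" and t2: "theta q (x * p) = - theta q y / y"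
        using theta_inverse[OF q(1), of x] theta_inverse[OF q(1), of y] nz by (auto simp: p_def)
      have t3: "theta q p = - theta q (x * y) / (x * y)"
        using theta_inverse[OF q(1), of "x * y"] nz by (simp add: p_def)
      show ?thesis
        unfolding g_def t1 t2 t3 K_def
        using th nz qq v(2) by (simp add: power2_eq_square divide_simps)
    qed
    obtain c where c: "((\<lambda>z. (p * (v z + g z)) / (z - p)) \<longlongrightarrow> c) (at p)"
      by (rule removable_at_simple_zero[of "\<lambda>z. p * (v z + g z)" p]) (use g_ana g1 v in \<open>auto intro!: analytic_intros\<close>)
    define B where "B = (\<lambda>z. C + q_zeta q z - (q_lambert q (q * v z) - q_lambert q (q / v z)))"
    have "B analytic_on {p}" unfolding B_def
      by (intro analytic_intros q_lambert_analytic q_zeta_analytic q v) (use nz p thp qq v in auto)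
    then have "(B \<longlongrightarrow> B p) (at p)"
      using analytic_at_imp_isCont isCont_def by blast
    then have "((\<lambda>z. B z + (p * (v z + g z)) / (z - p)) \<longlongrightarrow> B p + c) (at p)"
      using c by (intro tendsto_intros)
    moreover have "B z + (p * (v z + g z)) / (z - p) = h z" if "z \<noteq> p" for z
    proof -
      have Rz: "R z = g z / (1 - v z)"
        unfolding R_def g_def v_def theta_zero_part[OF q(1), of "x * y * z"] by simp
      have e2: "- v z / (1 - v z) - g z / (1 - v z) = p * (v z + g z) / (z - p)"
      proof -
        have e: "z - p = - p * (1 - v z)" using p by (simp add: v_def algebra_simps)
        then have "1 - v z \<noteq> 0" using that by auto
        then show ?thesis unfolding e using p by (simp add: divide_simps)
      qed
      have zp: "q_zeta q (x * y * z) = v z / (1 - v z) + (q_lambert q (q * v z) - q_lambert q (q / v z))"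
        unfolding v_def by (rule q_zeta_pole_part[OF q(1)])
      show ?thesis
        unfolding h_def B_def zp Rz e2[symmetric] by simp
    qed
    then have "eventually (\<lambda>z. B z + (p * (v z + g z)) / (z - p) = h z) (at p)"
      by (auto simp: eventually_at_filter)
    ultimately have "(h \<longlongrightarrow> B p + c) (at p)" by (rule Lim_transform_eventually)
    then show ?thesis by (rule not_pole_if_limit)
  qed
  have nopole: "\<not> is_pole h z" if z: "z \<noteq> 0" for z
  proof -
    consider "theta q z \<noteq> 0" "theta q (x * y * z) \<noteq> 0" | "theta q z = 0" | "theta q (x * y * z) = 0" by blast
    then show ?thesis
    proof cases
      case 1
      then show ?thesis using ana[OF z] analytic_at_imp_no_pole by blast
    next
      case 2
      then obtain k where "z = q powi k * 1" using theta_eq_0_iff[OF q z] by auto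
      then show ?thesis
        using pole1 powi_shift_invariant[where P = "is_pole h" and z = 1 and k = k, OF q(2) pole_per] by simp
    next
      case 3
      then obtain k where "x * y * z = q powi k" using theta_eq_0_iff[OF q, of "x * y * z"] nz z by auto
      then have "z = q powi k * p" using nz by (simp add: p_def field_simps)
      then show ?thesis
        using pole2 powi_shift_invariant[where P = "is_pole h" and z = p and k = k, OF q(2) pole_per] p by simp
    qed
  qed
  obtain c where c: "\<And>z. z \<noteq> 0 \<Longrightarrow> h analytic_on {z} \<Longrightarrow> h z = c"
    using multiplicative_elliptic_constant[OF q mero per nopole] by blast
  have "h (1 / y) = c"
    using theta_inverse[OF q(1), of y] nz th by (intro c ana) auto
  moreover have "h (1 / y) = 0"
  proof -
    have "y \<noteq> 1" using th(2) by (auto simp: theta_zero_part[OF q(1), of 1])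
    moreover have "theta q 1 = 0" by (simp add: theta_zero_part[OF q(1), of 1])
    ultimately show ?thesis using nz q_zeta_inverse[OF q(1), of y] by (simp add: h_def C_def R_def)
  qed
  moreover have "h z = c" using nz th by (intro c ana) auto
  ultimately show ?thesis by (simp add: h_def C_def R_def K_def algebra_simps)
qed

section \<open>Distribution relations\<close>

text \<open>Separating even and odd indices rearranges an infinite product, so it is done on the
  partial products of even length.\<close>

lemma tendsto_partial_products_even_odd:
  fixes f :: "nat \<Rightarrow> complex"
  assumes "(\<lambda>N. \<Prod>n<N. f n) \<longlonglongrightarrow> L" "(\<lambda>N. \<Prod>n<N. f (2 * n)) \<longlonglongrightarrow> L1" "(\<lambda>N. \<Prod>n<N. f (2 * n + 1)) \<longlonglongrightarrow> L2"
  shows "L = L1 * L2"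
proof -
  have eq: "(\<Prod>n<2 * N. f n) = (\<Prod>n<N. f (2 * n)) * (\<Prod>n<N. f (2 * n + 1))" for N
    by (induction N) (auto simp: mult_ac)
  have "filterlim (\<lambda>N. 2 * N :: nat) sequentially sequentially"
    by (rule filterlim_subseq) (auto simp: strict_mono_def)
  with assms(1) have "(\<lambda>N. \<Prod>n<2 * N. f n) \<longlonglongrightarrow> L"
    by (rule filterlim_compose)
  moreover have "(\<lambda>N. \<Prod>n<2 * N. f n) \<longlonglongrightarrow> L1 * L2"
    unfolding eq using assms(2,3) by (rule tendsto_mult)
  ultimately show ?thesis using LIMSEQ_unique by blast
qed

lemma q_pochhammer_tendsto:
  assumes "norm q < 1"
  shows "(\<lambda>N. \<Prod>n<N. 1 - z * q ^ n) \<longlonglongrightarrow> q_pochhammer q z"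
  using tendsto_uniform_limitI[OF q_pochhammer_uniform_limit[OF assms, of "{z}"]] by simp

lemma norm_power_less_one:
  fixes q :: complex
  assumes "norm q < 1" "n > 0"
  shows "norm (q ^ n) < 1"
  using assms by (simp add: norm_power power_less_one_iff)

text \<open>The three distribution relations for \<open>(z; q)\<^sub>\<infinity>\<close> below (splitting by parity of the exponent,
  and multiplying over square and cube roots of unity) are what turns theta values at points of
  order 6 into eta quotients.\<close>

lemma q_pochhammer_split:
  assumes "norm q < 1"
  shows "q_pochhammer q z = q_pochhammer (q\<^sup>2) z * q_pochhammer (q\<^sup>2) (q * z)"
proof (rule tendsto_partial_products_even_odd[OF q_pochhammer_tendsto[OF assms]])
  have q2: "norm (q\<^sup>2) < 1" using norm_power_less_one[OF assms] by simp
  show "(\<lambda>N. \<Prod>n<N. 1 - z * q ^ (2 * n)) \<longlonglongrightarrow> q_pochhammer (q\<^sup>2) z"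
    using q_pochhammer_tendsto[OF q2, of z] by (simp add: power_mult)
  show "(\<lambda>N. \<Prod>n<N. 1 - z * q ^ (2 * n + 1)) \<longlonglongrightarrow> q_pochhammer (q\<^sup>2) (q * z)"
  proof -
    have "z * q ^ (2 * n + 1) = q * z * (q\<^sup>2) ^ n" for n by (simp add: power_mult)
    then show ?thesis using q_pochhammer_tendsto[OF q2, of "q * z"] by (simp only:)
  qed
qed

lemma q_pochhammer_mult_neg:
  assumes "norm q < 1"
  shows "q_pochhammer q z * q_pochhammer q (- z) = q_pochhammer (q\<^sup>2) (z\<^sup>2)"
proof -
  have "(1 - z * q ^ n) * (1 - (- z) * q ^ n) = 1 - z\<^sup>2 * (q\<^sup>2) ^ n" for n
    by (simp add: power2_eq_square power_mult_distrib algebra_simps)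
  then show ?thesis
    unfolding q_pochhammer_def using prodinf_mult[OF q_pochhammer_convergent[OF assms, of z] q_pochhammer_convergent[OF assms, of "- z"]]
    by simp
qed

definition omega :: complex where "omega = Complex (- 1 / 2) (sqrt 3 / 2)"

lemma omega_square: "omega\<^sup>2 = - omega - 1"
  by (simp add: omega_def complex_eq_iff power2_eq_square)

lemma omega_cube: "omega ^ 3 = 1"
  using omega_square by algebra

lemma omega_neq [simp]: "omega \<noteq> 0" "omega \<noteq> 1" "1 - omega \<noteq> 0"
  by (auto simp: omega_def complex_eq_iff)

lemma inverse_omega: "1 / omega = omega\<^sup>2" "1 / omega\<^sup>2 = omega"
  using omega_cube by (auto simp: field_simps power3_eq_cube power2_eq_square)

lemma q_pochhammer_mult_omega:
  assumes "norm q < 1"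
  shows "q_pochhammer q z * q_pochhammer q (omega * z) * q_pochhammer q (omega\<^sup>2 * z) = q_pochhammer (q ^ 3) (z ^ 3)"
proof -
  have "(1 - x) * (1 - omega * x) * (1 - omega\<^sup>2 * x) = 1 - x ^ 3" for x
    using omega_square by algebra
  from this[of "z * q ^ n" for n]
  have *: "(1 - z * q ^ n) * (1 - omega * z * q ^ n) * (1 - omega\<^sup>2 * z * q ^ n) = 1 - z ^ 3 * (q ^ 3) ^ n" for n
    by (simp add: power_mult_distrib mult_ac flip: power_mult)
  note c = q_pochhammer_convergent[OF assms]
  show ?thesis
    unfolding q_pochhammer_def prodinf_mult[OF c c] prodinf_mult[OF convergent_prod_mult[OF c c] c] *
    by simp
qed

lemma q_lambert_split:
  assumes "norm q < 1"
  shows "q_lambert q z = q_lambert (q\<^sup>2) z + q_lambert (q\<^sup>2) (q * z)"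
proof -
  define f where "f = (\<lambda>n. z * q ^ n / (1 - z * q ^ n))"
  have q2: "norm (q\<^sup>2) < 1" using norm_power_less_one[OF assms] by simp
  have "f sums q_lambert q z" unfolding f_def q_lambert_def by (rule summable_sums[OF q_lambert_summable[OF assms]])
  then have 1: "(\<lambda>N. \<Sum>n<N. f n) \<longlonglongrightarrow> q_lambert q z" by (simp add: sums_def)
  have "(\<lambda>n. f (2 * n)) sums q_lambert (q\<^sup>2) z"
    unfolding f_def q_lambert_def using summable_sums[OF q_lambert_summable[OF q2, of z]] by (simp add: power_mult)
  moreover have "(\<lambda>n. f (2 * n + 1)) sums q_lambert (q\<^sup>2) (q * z)"
  proof -
    have "z * q ^ (2 * n + 1) = q * z * (q\<^sup>2) ^ n" for n by (simp add: power_mult)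
    then show ?thesis unfolding f_def q_lambert_def
      using summable_sums[OF q_lambert_summable[OF q2, of "q * z"]] by (simp only:)
  qed
  ultimately have "(\<lambda>N. (\<Sum>n<N. f (2 * n)) + (\<Sum>n<N. f (2 * n + 1))) \<longlonglongrightarrow> q_lambert (q\<^sup>2) z + q_lambert (q\<^sup>2) (q * z)"
    unfolding sums_def by (rule tendsto_add)
  moreover have "(\<Sum>n<N. f (2 * n)) + (\<Sum>n<N. f (2 * n + 1)) = (\<Sum>n<2 * N. f n)" for N
    by (induction N) (auto simp: add_ac)
  moreover have "filterlim (\<lambda>N. 2 * N :: nat) sequentially sequentially"
    by (rule filterlim_subseq) (auto simp: strict_mono_def)
  then have "(\<lambda>N. \<Sum>n<2 * N. f n) \<longlonglongrightarrow> q_lambert q z"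
    using 1 filterlim_compose by blast
  ultimately show ?thesis using LIMSEQ_unique by force
qed

lemma q_lambert_add_neg:
  assumes "norm q < 1" "q_pochhammer q z \<noteq> 0" "q_pochhammer q (- z) \<noteq> 0"
  shows "q_lambert q z + q_lambert q (- z) = 2 * q_lambert (q\<^sup>2) (z\<^sup>2)"
proof -
  have q2: "norm (q\<^sup>2) < 1" using norm_power_less_one[OF assms(1)] by simp
  have eq: "z * q ^ n / (1 - z * q ^ n) + (- z) * q ^ n / (1 - (- z) * q ^ n)
       = 2 * (z\<^sup>2 * (q\<^sup>2) ^ n / (1 - z\<^sup>2 * (q\<^sup>2) ^ n))" for n
  proof -
    define x where "x = z * q ^ n"
    have x: "1 - x \<noteq> 0" "1 + x \<noteq> 0"
      using assms(2,3) unfolding q_pochhammer_eq_0_iff[OF assms(1)] x_def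
      by (auto simp: algebra_simps add_eq_0_iff2)
    have "x / (1 - x) + (- x) / (1 - (- x)) = 2 * (x * x / ((1 - x) * (1 + x)))"
      using x by (simp add: divide_simps) (simp add: algebra_simps)
    also have "(1 - x) * (1 + x) = 1 - x * x" by (simp add: algebra_simps)
    also have "x * x = z\<^sup>2 * (q\<^sup>2) ^ n" by (simp add: x_def power2_eq_square power_mult_distrib)
    finally show ?thesis by (simp add: x_def)
  qed
  have "q_lambert q z + q_lambert q (- z) = (\<Sum>n. z * q ^ n / (1 - z * q ^ n) + (- z) * q ^ n / (1 - (- z) * q ^ n))"
    unfolding q_lambert_def by (rule suminf_add[OF q_lambert_summable[OF assms(1)] q_lambert_summable[OF assms(1)]])
  also have "\<dots> = 2 * q_lambert (q\<^sup>2) (z\<^sup>2)"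
    unfolding eq q_lambert_def by (rule suminf_mult[OF q_lambert_summable[OF q2]])
  finally show ?thesis .
qed

lemma q_zeta_split:
  assumes "norm q < 1" "q \<noteq> 0" "z \<noteq> 0"
  shows "q_zeta q z = q_zeta (q\<^sup>2) z + q_zeta (q\<^sup>2) (q * z)"
  unfolding q_zeta_def q_lambert_split[OF assms(1), of z] q_lambert_split[OF assms(1), of "q / z"]
  using assms by (simp add: power2_eq_square field_simps)

lemma q_zeta_add_neg:
  assumes "norm q < 1" "z \<noteq> 0" "theta q z \<noteq> 0" "theta q (- z) \<noteq> 0"
  shows "q_zeta q z + q_zeta q (- z) = 2 * q_zeta (q\<^sup>2) (z\<^sup>2)"
proof -
  have "q_zeta q z + q_zeta q (- z) = (q_lambert q z + q_lambert q (- z)) - (q_lambert q (q / z) + q_lambert q (- (q / z)))"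
    by (simp add: q_zeta_def)
  also have "q_lambert q z + q_lambert q (- z) = 2 * q_lambert (q\<^sup>2) (z\<^sup>2)"
    by (rule q_lambert_add_neg) (use assms in \<open>auto simp: theta_def\<close>)
  also have "q_lambert q (q / z) + q_lambert q (- (q / z)) = 2 * q_lambert (q\<^sup>2) ((q / z)\<^sup>2)"
    by (rule q_lambert_add_neg) (use assms in \<open>auto simp: theta_def\<close>)
  finally show ?thesis by (simp add: q_zeta_def power_divide)
qed

section \<open>Evaluation at points of order six\<close>

definition euler :: "complex \<Rightarrow> complex" where "euler q = q_pochhammer q q"

lemma euler_nonzero: "norm q < 1 \<Longrightarrow> euler q \<noteq> 0"
  by (simp add: euler_def q_pochhammer_nonzero_small)

text \<open>The Borwein cubic theta function \<open>a(q) = \<Sum> q\<^bsup>m\<^sup>2 + mn + n\<^sup>2\<^esup>\<close>, which is also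
  \<open>1 + 6 \<Sum> q\<^sup>n/(1 + q\<^sup>n + q\<^bsup>2n\<^esup>)\<close>; up to the factor \<open>\<omega> - \<omega>\<^sup>2\<close>, its terms are
  \<open>\<omega>q\<^sup>n/(1 - \<omega>q\<^sup>n) - \<omega>\<^sup>2q\<^sup>n/(1 - \<omega>\<^sup>2q\<^sup>n)\<close>. The factor \<open>-2(\<omega> - \<omega>\<^sup>2)\<close> makes the constant term \<open>1\<close>.\<close>

definition cubic_a :: "complex \<Rightarrow> complex" where
  "cubic_a q = - 2 * (omega - omega\<^sup>2) * (q_zeta q omega + 1 / 2)"

text \<open>\<open>(\<eta>(\<tau>) \<eta>(6\<tau>)\<^sup>3 / (\<eta>(2\<tau>) \<eta>(3\<tau>)\<^sup>3))\<^sup>3\<close>, a generator of the function field of \<open>X\<^sub>0(6)\<close>. In terms of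
  the Borwein function \<open>c(q)\<close> it is \<open>(c(q\<^sup>2)/c(q))\<^sup>3\<close>.\<close>

definition hauptmodul6 :: "complex \<Rightarrow> complex" where
  "hauptmodul6 q = q * (euler q * euler (q ^ 6) ^ 3 / (euler (q\<^sup>2) * euler (q ^ 3) ^ 3)) ^ 3"

text \<open>\<open>c(q)\<^sup>2 / (3c(q\<^sup>2))\<close>, a form of weight 1 without zeros in the disc; homogeneous quantities of
  weight \<open>k\<close> become \<open>g\<^sup>k\<close> times a polynomial in the Hauptmodul.\<close>

definition level6_form :: "complex \<Rightarrow> complex" where
  "level6_form q = euler (q ^ 3) ^ 6 * euler (q\<^sup>2) / (euler q ^ 2 * euler (q ^ 6) ^ 3)"

text \<open>The addition formula at the points \<open>(\<omega>, \<omega>, -1)\<close>, \<open>(\<omega>, \<omega>, s)\<close> and \<open>(s, s, s)\<close> for \<open>q\<close>,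
  where \<open>s = -\<omega>\<^sup>2\<close> is a primitive sixth root of unity, and at \<open>(q\<omega>, q\<omega>, q\<omega>)\<close> for \<open>q\<^sup>2\<close>. The zeta
  values involved reduce to \<open>\<zeta>\<^sub>q(\<omega>)\<close> and \<open>\<zeta>\<^bsub>q\<^sup>2\<^esub>(\<omega>)\<close>, that is to \<open>a(q)\<close> and \<open>a(q\<^sup>2)\<close>, by
  \<open>\<zeta>\<^sub>q(z) + \<zeta>\<^sub>q(-z) = 2\<zeta>\<^bsub>q\<^sup>2\<^esub>(z\<^sup>2)\<close> and \<open>\<zeta>\<^sub>q(z) = \<zeta>\<^bsub>q\<^sup>2\<^esub>(z) + \<zeta>\<^bsub>q\<^sup>2\<^esub>(qz)\<close>.\<close>

lemma cubic_a_values: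
  assumes q: "norm q < 1" "q \<noteq> 0"
  defines "P1 \<equiv> euler q" and "P2 \<equiv> euler (q\<^sup>2)" and "P3 \<equiv> euler (q ^ 3)" and "P6 \<equiv> euler (q ^ 6)"
  shows "2 * cubic_a (q\<^sup>2) - cubic_a q = P1 ^ 6 * P6 / (P3 ^ 2 * P2 ^ 3)" (is ?I3)
    and "cubic_a q + cubic_a (q\<^sup>2) = 2 * P2 ^ 6 * P3 / (P6 ^ 2 * P1 ^ 3)" (is ?I4)
    and "cubic_a q + 2 * cubic_a (q\<^sup>2) = 3 * P3 ^ 6 * P2 / (P1 ^ 2 * P6 ^ 3)" (is ?I1)
    and "cubic_a q - cubic_a (q\<^sup>2) = 6 * q * P6 ^ 6 * P1 / (P2 ^ 2 * P3 ^ 3)" (is ?I2)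
proof -
  define w where "w = omega"
  have w: "w\<^sup>2 = - w - 1" "w ^ 3 = 1" "w \<noteq> 0" "w \<noteq> 1" "1 - w \<noteq> 0" "1 / w = w\<^sup>2" "1 / w\<^sup>2 = w"
    using omega_square omega_cube inverse_omega by (auto simp: w_def)
  have w4: "w ^ 4 = w" using w(2) by (simp add: eval_nat_numeral)
  have dw: "x / w = w\<^sup>2 * x" for x
    using w(6) by (metis mult.commute times_divide_eq_right mult_1_right)
  define s where "s = - w\<^sup>2"
  have s: "s \<noteq> 0" "s ^ 3 = - 1" "s * s = w" "1 / s = - w" "w * s = - 1" "w * w * s = - w" "1 - s = - w"
    using w w4 by (auto simp: s_def power2_eq_square eval_nat_numeral field_simps)
  have q2: "norm (q\<^sup>2) < 1" "q\<^sup>2 \<noteq> 0" using norm_power_less_one[OF q(1)] q by auto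
  have nz: "P1 \<noteq> 0" "P2 \<noteq> 0" "P3 \<noteq> 0" "P6 \<noteq> 0"
    using norm_power_less_one[OF q(1)] q by (auto simp: P1_def P2_def P3_def P6_def intro!: euler_nonzero)
  have T1: "q_pochhammer q q = P1" by (simp add: P1_def euler_def)
  have T2: "q_pochhammer (q\<^sup>2) (q\<^sup>2) = P2" by (simp add: P2_def euler_def)
  have Todd: "q_pochhammer (q\<^sup>2) q = P1 / P2"
    using q_pochhammer_split[OF q(1), of q] T1 T2 nz by (simp add: power2_eq_square)
  have Tneg: "q_pochhammer q (- q) = P2 / P1"
    using q_pochhammer_mult_neg[OF q(1), of q] T1 T2 nz by (simp add: field_simps)
  have Tw: "q_pochhammer q (w * q) * q_pochhammer q (w\<^sup>2 * q) = P3 / P1"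
    using q_pochhammer_mult_omega[OF q(1), of q] T1 nz by (simp add: P3_def euler_def w_def field_simps)
  have Tw2: "q_pochhammer (q\<^sup>2) (w * q\<^sup>2) * q_pochhammer (q\<^sup>2) (w\<^sup>2 * q\<^sup>2) = P6 / P2"
    using q_pochhammer_mult_omega[OF q2(1), of "q\<^sup>2"] T2 nz by (simp add: P6_def euler_def w_def field_simps flip: power_mult)
  have Tnw: "q_pochhammer q (- (w * q)) * q_pochhammer q (- (w\<^sup>2 * q)) = (P6 / P2) / (P3 / P1)"
  proof -
    have "q_pochhammer q (w * q) * q_pochhammer q (- (w * q)) = q_pochhammer (q\<^sup>2) (w\<^sup>2 * q\<^sup>2)"
      using q_pochhammer_mult_neg[OF q(1), of "w * q"] by (simp add: power_mult_distrib)
    moreover have "q_pochhammer q (w\<^sup>2 * q) * q_pochhammer q (- (w\<^sup>2 * q)) = q_pochhammer (q\<^sup>2) (w * q\<^sup>2)"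
      using q_pochhammer_mult_neg[OF q(1), of "w\<^sup>2 * q"] w4 by (simp add: power_mult_distrib flip: power_mult)
    moreover have "q_pochhammer q (w * q) * q_pochhammer q (w\<^sup>2 * q) * (q_pochhammer q (- (w * q)) * q_pochhammer q (- (w\<^sup>2 * q)))
        = (q_pochhammer q (w * q) * q_pochhammer q (- (w * q))) * (q_pochhammer q (w\<^sup>2 * q) * q_pochhammer q (- (w\<^sup>2 * q)))"
      by (simp only: mult_ac)
    ultimately have "q_pochhammer q (w * q) * q_pochhammer q (w\<^sup>2 * q) * (q_pochhammer q (- (w * q)) * q_pochhammer q (- (w\<^sup>2 * q))) = P6 / P2"
      unfolding Tw2[symmetric] by (simp only: mult.commute)
    then show ?thesis unfolding Tw using nz by (simp add: field_simps)
  qed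
  have Todd_w: "q_pochhammer (q\<^sup>2) (w * q) * q_pochhammer (q\<^sup>2) (w\<^sup>2 * q) = (P3 / P1) / (P6 / P2)"
  proof -
    have "q_pochhammer q (w * q) = q_pochhammer (q\<^sup>2) (w * q) * q_pochhammer (q\<^sup>2) (w * q\<^sup>2)"
      "q_pochhammer q (w\<^sup>2 * q) = q_pochhammer (q\<^sup>2) (w\<^sup>2 * q) * q_pochhammer (q\<^sup>2) (w\<^sup>2 * q\<^sup>2)"
      using q_pochhammer_split[OF q(1), of "w * q"] q_pochhammer_split[OF q(1), of "w\<^sup>2 * q"]
      by (auto simp: power2_eq_square mult_ac)
    then have "q_pochhammer (q\<^sup>2) (w * q) * q_pochhammer (q\<^sup>2) (w\<^sup>2 * q) * (P6 / P2) = P3 / P1"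
      unfolding Tw2[symmetric] Tw[symmetric] by (simp add: mult_ac)
    then show ?thesis using nz by (simp add: field_simps)
  qed
  define e2 e3 e6 where "e2 = P2 / P1" and "e3 = P3 / P1" and "e6 = P6 * P1 / (P2 * P3)"
  have enz: "e2 \<noteq> 0" "e3 \<noteq> 0" "e6 \<noteq> 0" using nz by (auto simp: e2_def e3_def e6_def)
  have th_w: "theta q w = (1 - w) * e3"
    unfolding theta_zero_part[OF q(1), of w] dw e3_def using Tw by (simp add: mult_ac)
  have th_w2: "theta q (w\<^sup>2) = - w\<^sup>2 * (1 - w) * e3"
    using theta_inverse[OF q(1) w(3)] unfolding w(6) th_w dw by simp
  have th_m1: "theta q (- 1) = 2 * e2\<^sup>2"
    using theta_zero_part[OF q(1), of "- 1"] Tneg by (simp add: e2_def power2_eq_square)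
  have th_s: "theta q s = - w * e6"
  proof -
    have "q / s = q * (1 / s)" by simp
    then have "q / s = - (w * q)" unfolding s(4) by simp
    moreover have "q * s = - (w\<^sup>2 * q)" by (simp add: s_def)
    ultimately show ?thesis
      using theta_zero_part[OF q(1), of s] Tnw s(7) nz by (simp add: e6_def mult_ac)
  qed
  have th_mw: "theta q (- w) = - w\<^sup>2 * e6"
  proof -
    have "theta q (1 / s) = - theta q s * (1 / s)" using theta_inverse[OF q(1) s(1)] by simp
    then show ?thesis unfolding s(4) th_s by (simp add: power2_eq_square)
  qed
  have th2_w: "theta (q\<^sup>2) w = (1 - w) * (P6 / P2)"
    unfolding theta_zero_part[OF q2(1), of w] dw using Tw2 by (simp add: mult_ac)
  have th2_w2: "theta (q\<^sup>2) (w\<^sup>2) = - w\<^sup>2 * (1 - w) * (P6 / P2)"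
    using theta_inverse[OF q2(1) w(3)] unfolding w(6) th2_w dw by simp
  have th2_q: "theta (q\<^sup>2) q = (P1 / P2)\<^sup>2"
    using Todd q by (simp add: theta_def power2_eq_square)
  have th2_qw: "theta (q\<^sup>2) (q * w) = (P3 / P1) / (P6 / P2)"
  proof -
    have "q\<^sup>2 / (q * w) = w\<^sup>2 * q" using dw[of q] q by (simp add: power2_eq_square field_simps)
    then show ?thesis using Todd_w by (simp add: theta_def mult_ac)
  qed
  define Z where "Z = q_zeta q w + 1 / 2"
  define Z2 where "Z2 = q_zeta (q\<^sup>2) w + 1 / 2"
  have zm1: "q_zeta q (- 1) = - 1 / 2"
  proof -
    have "q_zeta q (- 1) = - q_zeta q (- 1) - 1" using q_zeta_inverse[OF q(1), of "- 1"] by simp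
    then have "2 * q_zeta q (- 1) = - 1" by algebra
    then have "2 * q_zeta q (- 1) / 2 = - 1 / 2" by (simp only:)
    then show ?thesis by simp
  qed
  have z2w2: "q_zeta (q\<^sup>2) (w\<^sup>2) = - Z2 - 1 / 2"
    using q_zeta_inverse[OF q2(1) w(3,4)] unfolding w(6) by (simp add: Z2_def)
  have zmw: "q_zeta q (- w) = - q_zeta q s - 1"
  proof -
    have "s \<noteq> 1" using s(7) w(3) by auto
    then show ?thesis using q_zeta_inverse[OF q(1) s(1)] unfolding s(4) by simp
  qed
  have zs: "q_zeta q s = Z + 2 * Z2 - 1 / 2"
  proof -
    have "q_zeta q w + q_zeta q (- w) = 2 * q_zeta (q\<^sup>2) (w\<^sup>2)"
      by (rule q_zeta_add_neg) (use q w(3,5) enz in \<open>simp_all add: th_w th_mw\<close>)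
    then show ?thesis unfolding zmw z2w2 Z_def by algebra
  qed
  have ww: "w * w = w\<^sup>2" by (simp add: power2_eq_square)
  have aA: "cubic_a q = - 2 * (w - w\<^sup>2) * Z" "cubic_a (q\<^sup>2) = - 2 * (w - w\<^sup>2) * Z2"
    by (simp_all add: cubic_a_def Z_def Z2_def w_def)
  have wnum: "(w - w\<^sup>2) = w * (1 - w)" by (simp add: power2_eq_square algebra_simps)
  have w1: "w * w * (- 1) = s" "w * (- 1) = - w" "w\<^sup>2 * (- 1) = s" by (simp_all add: s_def power2_eq_square)
  have w2s: "w\<^sup>2 * s = - w" using s(6) by (simp add: ww)
  have "Z - 2 * Z2 = q_zeta q w + q_zeta q w + q_zeta q (- 1) - q_zeta q (w * w * (- 1)) + 1"
    unfolding w1 zm1 zs by (simp add: Z_def)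
  also have "\<dots> = q_pochhammer q q ^ 2 * theta q (w * w) * theta q (w * (- 1)) * theta q (w * (- 1)) /
       (theta q w * theta q w * theta q (- 1) * theta q (w * w * (- 1)))"
    by (rule q_zeta_addition) (use q w(3,5) enz in \<open>simp_all only: w1 ww th_w th_w2 th_m1 th_s th_mw, simp_all\<close>)
  also have "\<dots> = w\<^sup>2 * P1\<^sup>2 * e6 / (2 * (1 - w) * e3 * e2\<^sup>2)"
    unfolding w1 ww T1 th_w th_w2 th_m1 th_s th_mw
  proof (subst frac_eq_eq)
    show "P1\<^sup>2 * (- w\<^sup>2 * (1 - w) * e3) * (- w\<^sup>2 * e6) * (- w\<^sup>2 * e6) * (2 * (1 - w) * e3 * e2\<^sup>2) =
      w\<^sup>2 * P1\<^sup>2 * e6 * ((1 - w) * e3 * ((1 - w) * e3) * (2 * e2\<^sup>2) * (- w * e6))"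
      using w(2) by algebra
  qed (use enz w(3,5) in auto)
  finally have Z3: "Z - 2 * Z2 = w\<^sup>2 * P1\<^sup>2 * e6 / (2 * (1 - w) * e3 * e2\<^sup>2)" .
  have "2 * cubic_a (q\<^sup>2) - cubic_a q = 2 * w * (1 - w) * (Z - 2 * Z2)"
    unfolding aA wnum by algebra
  also have "\<dots> = w ^ 3 * (P1\<^sup>2 * e6 / (e3 * e2\<^sup>2))"
    unfolding Z3 power3_eq_cube power2_eq_square using w(5) enz by (simp add: divide_simps)
  also have "\<dots> = P1 ^ 6 * P6 / (P3 ^ 2 * P2 ^ 3)"
    unfolding w(2) e2_def e3_def e6_def using nz by (simp add: field_simps eval_nat_numeral)
  finally show ?I3 .

  have "4 * (Z + Z2) = q_zeta q w + q_zeta q w + q_zeta q s - q_zeta q (w * w * s) + 1"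
    unfolding s(6) zmw zs by (simp add: Z_def)
  also have "\<dots> = q_pochhammer q q ^ 2 * theta q (w * w) * theta q (w * s) * theta q (w * s) /
       (theta q w * theta q w * theta q s * theta q (w * w * s))"
    by (rule q_zeta_addition) (use q w(3,5) s(1) enz in \<open>simp_all only: w2s s(5,6) ww th_w th_w2 th_m1 th_s th_mw, simp_all\<close>)
  also have "\<dots> = - 4 * w\<^sup>2 * P1\<^sup>2 * e2 ^ 4 / ((1 - w) * e3 * e6\<^sup>2)"
    unfolding s(5,6) w2s ww T1 th_w th_w2 th_m1 th_s th_mw
  proof (subst frac_eq_eq)
    show "P1\<^sup>2 * (- w\<^sup>2 * (1 - w) * e3) * (2 * e2\<^sup>2) * (2 * e2\<^sup>2) * ((1 - w) * e3 * e6\<^sup>2) =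
      - 4 * w\<^sup>2 * P1\<^sup>2 * e2 ^ 4 * ((1 - w) * e3 * ((1 - w) * e3) * (- w * e6) * (- w\<^sup>2 * e6))"
      using w(2) by algebra
  qed (use enz w(3,5) in auto)
  finally have Z4: "4 * (Z + Z2) = - 4 * w\<^sup>2 * P1\<^sup>2 * e2 ^ 4 / ((1 - w) * e3 * e6\<^sup>2)" .
  have "cubic_a q + cubic_a (q\<^sup>2) = - (w * (1 - w) / 2) * (4 * (Z + Z2))"
    unfolding aA wnum by algebra
  also have "\<dots> = w ^ 3 * (2 * P1\<^sup>2 * e2 ^ 4 / (e3 * e6\<^sup>2))"
    unfolding Z4 power3_eq_cube power2_eq_square using w(5) enz by (simp add: divide_simps)
  also have "\<dots> = 2 * P2 ^ 6 * P3 / (P6 ^ 2 * P1 ^ 3)"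
    unfolding w(2) e2_def e3_def e6_def using nz by (simp add: field_simps eval_nat_numeral)
  finally show ?I4 .

  have sss: "s * s * s = - 1" using s(2) by (simp add: power3_eq_cube)
  have "3 * (Z + 2 * Z2) = q_zeta q s + q_zeta q s + q_zeta q s - q_zeta q (s * s * s) + 1"
    unfolding sss zm1 zs by simp
  also have "\<dots> = q_pochhammer q q ^ 2 * theta q (s * s) * theta q (s * s) * theta q (s * s) /
       (theta q s * theta q s * theta q s * theta q (s * s * s))"
    by (rule q_zeta_addition) (use q s(1) enz w(3,5) in \<open>simp_all only: sss s(3,5) th_w th_m1 th_s, simp_all\<close>)
  also have "\<dots> = - ((1 - w) ^ 3) * P1\<^sup>2 * e3 ^ 3 / (2 * e6 ^ 3 * e2\<^sup>2)"
    unfolding sss s(3,5) T1 th_w th_m1 th_s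
  proof (subst frac_eq_eq)
    show "P1\<^sup>2 * ((1 - w) * e3) * ((1 - w) * e3) * ((1 - w) * e3) * (2 * e6 ^ 3 * e2\<^sup>2) =
      - ((1 - w) ^ 3) * P1\<^sup>2 * e3 ^ 3 * (- w * e6 * (- w * e6) * (- w * e6) * (2 * e2\<^sup>2))"
      using w(2) by algebra
  qed (use enz w(3,5) in auto)
  finally have Z1: "3 * (Z + 2 * Z2) = - ((1 - w) ^ 3) * P1\<^sup>2 * e3 ^ 3 / (2 * e6 ^ 3 * e2\<^sup>2)" .
  have three: "\<And>x y :: complex. 3 * x = 3 * y \<Longrightarrow> x = y" by simp
  have aux: "- 2 * w * c * (- (c ^ 3) * A * B / (2 * C * D)) = w * c ^ 4 * (A * B / (C * D))" for c A B C D :: complex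
    by (simp add: eval_nat_numeral)
  \<comment> \<open>\<open>(1 - \<omega>)\<^sup>2 = -3\<omega>\<close>\<close>
  have w9: "w * (1 - w) ^ 4 = 9" using w(1) by algebra
  have "3 * (cubic_a q + 2 * cubic_a (q\<^sup>2)) = - 2 * w * (1 - w) * (3 * (Z + 2 * Z2))"
    unfolding aA wnum by algebra
  also have "\<dots> = w * (1 - w) ^ 4 * (P1\<^sup>2 * e3 ^ 3 / (e6 ^ 3 * e2\<^sup>2))"
    unfolding Z1 by (rule aux)
  also have "\<dots> = 3 * (3 * P3 ^ 6 * P2 / (P1 ^ 2 * P6 ^ 3))"
    unfolding w9 e2_def e3_def e6_def using nz by (simp add: field_simps eval_nat_numeral)
  finally show ?I1 by (rule three)

  \<comment> \<open>In the remaining case \<open>xyz = q\<^sup>3\<close>, and \<open>\<zeta>\<^bsub>q\<^sup>2\<^esub>(q) = 0\<close> by symmetry.\<close>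
  have qw3: "q * w * (q * w) * (q * w) = q\<^sup>2 * q" "q * w * (q * w) = q\<^sup>2 * w\<^sup>2"
    "q\<^sup>2 * w\<^sup>2 * (q * w) = q\<^sup>2 * q"
    using w(2) by (auto simp: power2_eq_square power3_eq_cube mult_ac)
  have th2_qq: "theta (q\<^sup>2) (q\<^sup>2 * q) = - (P1 / P2)\<^sup>2 / q"
    using theta_qshift[OF q2 q(2)] th2_q by simp
  have th2_qw2: "theta (q\<^sup>2) (q\<^sup>2 * w\<^sup>2) = (1 - w) * (P6 / P2)"
    using theta_qshift[OF q2, of "w\<^sup>2"] th2_w2 w(3) by simp
  have "q \<noteq> 1" using q(1) by auto
  then have "q_zeta (q\<^sup>2) (q\<^sup>2 * q) = 1"
    using q_zeta_qshift[OF q2 q(2)] q by (simp add: q_zeta_def power2_eq_square)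
  moreover have "q_zeta (q\<^sup>2) (q * w) + q_zeta (q\<^sup>2) (q * w) + q_zeta (q\<^sup>2) (q * w) - q_zeta (q\<^sup>2) (q * w * (q * w) * (q * w)) + 1 =
      q_pochhammer (q\<^sup>2) (q\<^sup>2) ^ 2 * theta (q\<^sup>2) (q * w * (q * w)) * theta (q\<^sup>2) (q * w * (q * w)) * theta (q\<^sup>2) (q * w * (q * w)) /
       (theta (q\<^sup>2) (q * w) * theta (q\<^sup>2) (q * w) * theta (q\<^sup>2) (q * w) * theta (q\<^sup>2) (q * w * (q * w) * (q * w)))"
    by (rule q_zeta_addition) (use q2 q w(3,5) nz in \<open>simp_all only: qw3 th2_qq th2_qw th2_qw2, simp_all\<close>)
  moreover have "q_zeta (q\<^sup>2) (q * w) = Z - Z2"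
    using q_zeta_split[OF q w(3)] by (simp add: Z_def Z2_def)
  ultimately have "3 * (Z - Z2) = P2\<^sup>2 * theta (q\<^sup>2) (q\<^sup>2 * w\<^sup>2) ^ 3 / (theta (q\<^sup>2) (q * w) ^ 3 * theta (q\<^sup>2) (q\<^sup>2 * q))"
    unfolding qw3 by (simp add: T2 power3_eq_cube mult_ac)
  then have Z0: "3 * (Z - Z2) = - q * P2\<^sup>2 * ((1 - w) * (P6 / P2)) ^ 3 / (((P3 / P1) / (P6 / P2)) ^ 3 * (P1 / P2)\<^sup>2)"
    unfolding th2_qq th2_qw th2_qw2 using nz q by simp
  have "3 * (cubic_a q - cubic_a (q\<^sup>2)) = - 2 * w * (1 - w) * (3 * (Z - Z2))"
    unfolding aA wnum by algebra
  also have "\<dots> = 2 * (w * (1 - w) ^ 4) * (q * P2\<^sup>2 * (P6 / P2) ^ 3 / (((P3 / P1) / (P6 / P2)) ^ 3 * (P1 / P2)\<^sup>2))"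
    unfolding Z0 by (simp add: power_mult_distrib eval_nat_numeral)
  also have "\<dots> = 3 * (6 * q * P6 ^ 6 * P1 / (P2 ^ 2 * P3 ^ 3))"
    unfolding w9 using nz by (simp add: field_simps eval_nat_numeral)
  finally show ?I2 by (rule three)
qed

section \<open>Lambert series in the nome\<close>

text \<open>Since division by zero yields zero, the term with index \<open>0\<close> is \<open>0\<close>, and Lambert series may
  start there.\<close>

definition lambert_term :: "complex \<Rightarrow> nat \<Rightarrow> complex" where
  "lambert_term q n = q ^ n / (1 - q ^ n)"

definition lambert :: "nat \<Rightarrow> complex \<Rightarrow> complex" where
  "lambert k q = (\<Sum>n. of_nat n ^ k * lambert_term q n)"

lemma lambert_term_0 [simp]: "lambert_term q 0 = 0"
  by (simp add: lambert_term_def)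

lemma summable_power_times_geometric:
  fixes r :: real
  assumes "0 \<le> r" "r < 1"
  shows "summable (\<lambda>n. real n ^ k * r ^ n)"
  using assms
proof (induction k arbitrary: r)
  case 0
  then show ?case by (simp add: summable_geometric)
next
  case (Suc k)
  \<comment> \<open>One factor \<open>n\<close> is absorbed by half of the geometric decay.\<close>
  define s where "s = sqrt r"
  have s: "0 \<le> s" "s < 1" "s * s = r" using Suc.prems by (auto simp: s_def)
  have "(\<lambda>n. real n * s ^ n) \<longlonglongrightarrow> 0" using powser_times_n_limit_0[of s] s by simp
  then obtain C where C: "\<And>n. norm (real n * s ^ n) \<le> C"
    by (metis Bseq_def convergent_imp_Bseq convergentI)
  show ?case
  proof (rule summable_comparison_test')
    show "summable (\<lambda>n. C * (real n ^ k * s ^ n))" by (intro summable_mult Suc.IH s)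
    show "norm (real n ^ Suc k * r ^ n) \<le> C * (real n ^ k * s ^ n)" for n
    proof -
      have "norm (real n ^ Suc k * r ^ n) = norm (real n * s ^ n) * (real n ^ k * s ^ n)"
        using s by (simp add: norm_mult flip: s(3)) (simp add: power_mult_distrib abs_mult mult_ac)
      also have "\<dots> \<le> C * (real n ^ k * s ^ n)" using C[of n] s by (intro mult_right_mono) auto
      finally show ?thesis .
    qed
  qed
qed

lemma norm_one_minus_power_ge:
  fixes q :: complex
  assumes "norm q \<le> r" "r < 1" "n > 0"
  shows "1 - r \<le> norm (1 - q ^ n)"
proof -
  have r0: "0 \<le> r" using assms(1) norm_ge_zero order_trans by blast
  have "norm (q ^ n) \<le> r ^ n" using assms by (simp add: norm_power power_mono)
  also have "r ^ n \<le> r ^ 1" using assms r0 by (intro power_decreasing) auto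
  finally show ?thesis using norm_triangle_ineq2[of 1 "q ^ n"] by simp
qed

lemma one_minus_power_nonzero:
  fixes q :: complex
  assumes "norm q < 1" "n > 0"
  shows "1 - q ^ n \<noteq> 0"
  using norm_one_minus_power_ge[OF order_refl assms] assms by auto

lemma lambert_term_bound:
  assumes "norm q \<le> r" "r < 1"
  shows "norm (of_nat n ^ k * lambert_term q n) \<le> 1 / (1 - r) * (real n ^ k * r ^ n)"
proof (cases "n = 0")
  case True
  then show ?thesis using assms by simp
next
  case False
  have r0: "0 \<le> r" using assms(1) norm_ge_zero order_trans by blast
  have "norm (q ^ n) / norm (1 - q ^ n) \<le> r ^ n / (1 - r)"
    using norm_one_minus_power_ge[OF assms, of n] False assms r0
    by (intro frac_le) (auto simp: norm_power power_mono)
  then have "real n ^ k * (norm (q ^ n) / norm (1 - q ^ n)) \<le> real n ^ k * (r ^ n / (1 - r))"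
    by (intro mult_left_mono) auto
  then show ?thesis by (simp add: lambert_term_def norm_mult norm_divide norm_power)
qed

lemma lambert_term_norm_summable:
  assumes "norm q < 1"
  shows "summable (\<lambda>n. norm (of_nat n ^ k * lambert_term q n))"
proof (rule summable_comparison_test')
  show "summable (\<lambda>n. 1 / (1 - norm q) * (real n ^ k * norm q ^ n))"
    using assms by (intro summable_mult summable_power_times_geometric) auto
  show "norm (norm (of_nat n ^ k * lambert_term q n)) \<le> 1 / (1 - norm q) * (real n ^ k * norm q ^ n)" for n
    using lambert_term_bound[OF order_refl assms] by simp
qed

lemma lambert_sums:
  assumes "norm q < 1"
  shows "(\<lambda>n. of_nat n ^ k * lambert_term q n) sums lambert k q"
  unfolding lambert_def by (rule summable_sums[OF summable_norm_cancel[OF lambert_term_norm_summable[OF assms]]])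

lemma lambert_eq_Suc:
  assumes "norm q < 1"
  shows "lambert k q = (\<Sum>n. of_nat (Suc n) ^ k * q ^ Suc n / (1 - q ^ Suc n))"
  using suminf_split_head[OF sums_summable[OF lambert_sums[OF assms, of k]]]
  by (simp add: lambert_def) (simp add: lambert_term_def)

lemma lambert_0 [simp]: "lambert k 0 = 0"
proof -
  have "lambert_term 0 n = 0" for n by (cases n) (auto simp: lambert_term_def)
  then show ?thesis by (simp add: lambert_def)
qed

lemma cball_in_unit_ball:
  fixes x :: complex
  assumes "x \<in> ball 0 1"
  obtains d r where "d > 0" "r < 1" "0 \<le> r" "cball x d \<subseteq> cball 0 r" "cball x d \<subseteq> ball 0 1"
proof -
  define d where "d = (1 - norm x) / 2"
  have "norm y \<le> d + norm x" if "y \<in> cball x d" for y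
    using that norm_triangle_ineq2[of y x] by (simp add: dist_norm norm_minus_commute)
  moreover have "d > 0" "d + norm x < 1" using assms by (auto simp: d_def field_simps)
  ultimately show ?thesis using that[of d "d + norm x"] by force
qed

lemma lambert_uniform_limit:
  assumes "r < 1" "0 \<le> r"
  shows "uniform_limit (cball 0 r) (\<lambda>N q. \<Sum>n<N. of_nat n ^ k * lambert_term q n) (lambert k) sequentially"
  unfolding lambert_def
proof (rule Weierstrass_m_test)
  show "norm (of_nat n ^ k * lambert_term q n) \<le> 1 / (1 - r) * (real n ^ k * r ^ n)" if "q \<in> cball 0 r" for n q
    by (rule lambert_term_bound) (use that assms in auto)
  show "summable (\<lambda>n. 1 / (1 - r) * (real n ^ k * r ^ n))"
    using assms by (intro summable_mult summable_power_times_geometric) auto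
qed

lemma lambert_term_has_derivative:
  assumes "norm q < 1" "q \<noteq> 0"
  shows "((\<lambda>q. lambert_term q n) has_field_derivative of_nat n * lambert_term q n * (1 + lambert_term q n) / q) (at q)"
proof (cases "n = 0")
  case False
  have nz: "1 - q ^ n \<noteq> 0" by (rule one_minus_power_nonzero) (use assms False in auto)
  have "q ^ n = q * q ^ (n - 1)" using False by (cases n) auto
  then show ?thesis unfolding lambert_term_def
    using nz assms by (auto intro!: derivative_eq_intros simp: divide_simps power2_eq_square) (simp add: algebra_simps)
qed simp

lemma lambert_term_holomorphic: "(\<lambda>q. lambert_term q n) holomorphic_on ball 0 1"
proof (cases "n = 0")
  case False
  then show ?thesis unfolding lambert_term_def
    using one_minus_power_nonzero[of _ n] by (intro holomorphic_intros) auto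
qed simp

lemma lambert_holomorphic: "lambert k holomorphic_on ball 0 1"
proof (rule holomorphic_uniform_sequence)
  show "(\<lambda>q. \<Sum>n<N. of_nat n ^ k * lambert_term q n) holomorphic_on ball 0 1" for N
    by (intro holomorphic_intros lambert_term_holomorphic)
  show "\<exists>d>0. cball x d \<subseteq> ball 0 1 \<and> uniform_limit (cball x d) (\<lambda>N q. \<Sum>n<N. of_nat n ^ k * lambert_term q n) (lambert k) sequentially"
    if x: "x \<in> ball 0 1" for x
  proof -
    obtain d r where "d > 0" "r < 1" "0 \<le> r" "cball x d \<subseteq> cball 0 r" "cball x d \<subseteq> ball 0 1"
      using cball_in_unit_ball[OF x] .
    then show ?thesis using uniform_limit_on_subset[OF lambert_uniform_limit] by blast
  qed
qed auto

lemma lambert_1_derivative: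
  assumes "norm q < 1" "q \<noteq> 0"
  shows "(\<lambda>n. of_nat n ^ 2 * lambert_term q n * (1 + lambert_term q n)) sums (q * deriv (lambert 1) q)"
proof -
  have "\<exists>g'. \<forall>x\<in>ball 0 1 - {0}. (lambert 1 has_field_derivative g' x) (at x) \<and>
      (\<lambda>N. \<Sum>n<N. of_nat n ^ 2 * lambert_term x n * (1 + lambert_term x n) / x) \<longlonglongrightarrow> g' x"
  proof (rule has_complex_derivative_uniform_sequence)
    show "((\<lambda>q. \<Sum>n<N. of_nat n ^ 1 * lambert_term q n) has_field_derivative
        (\<Sum>n<N. of_nat n ^ 2 * lambert_term x n * (1 + lambert_term x n) / x)) (at x)" if "x \<in> ball 0 1 - {0}" for N x
    proof (rule DERIV_sum)
      fix n assume "n \<in> {..<N}"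
      have "((\<lambda>q. of_nat n * lambert_term q n) has_field_derivative of_nat n * (of_nat n * lambert_term x n * (1 + lambert_term x n) / x)) (at x)"
        using that by (intro DERIV_cmult lambert_term_has_derivative) auto
      then show "((\<lambda>q. of_nat n ^ 1 * lambert_term q n) has_field_derivative of_nat n ^ 2 * lambert_term x n * (1 + lambert_term x n) / x) (at x)"
        by (simp add: power2_eq_square mult_ac)
    qed
    show "\<exists>d>0. cball x d \<subseteq> ball 0 1 - {0} \<and> uniform_limit (cball x d) (\<lambda>N q. \<Sum>n<N. of_nat n ^ 1 * lambert_term q n) (lambert 1) sequentially"
      if x: "x \<in> ball 0 1 - {0}" for x
    proof -
      obtain d r where d: "d > 0" "r < 1" "0 \<le> r" "cball x d \<subseteq> cball 0 r" "cball x d \<subseteq> ball 0 1"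
        using cball_in_unit_ball[of x] x by blast
      define d' where "d' = min d (norm x / 2)"
      have "d' > 0" "cball x d' \<subseteq> cball x d" "0 \<notin> cball x d'"
        using x d by (auto simp: d'_def)
      then show ?thesis using d uniform_limit_on_subset[OF lambert_uniform_limit[of r 1]]
        by (intro exI[of _ d']) auto
    qed
  qed auto
  then have "(\<lambda>N. \<Sum>n<N. of_nat n ^ 2 * lambert_term q n * (1 + lambert_term q n) / q) \<longlonglongrightarrow> deriv (lambert 1) q"
    using assms DERIV_imp_deriv by fastforce
  then have "(\<lambda>N. q * (\<Sum>n<N. of_nat n ^ 2 * lambert_term q n * (1 + lambert_term q n) / q)) \<longlonglongrightarrow> q * deriv (lambert 1) q"
    by (intro tendsto_intros)
  then show ?thesis unfolding sums_def using assms by (simp add: sum_distrib_left)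
qed

section \<open>Ramanujan's differential equation\<close>

text \<open>With \<open>u\<^sub>n = q\<^sup>n/(1 - q\<^sup>n)\<close> this reads \<open>u\<^sub>m u\<^sub>n = u\<^bsub>m+n\<^esub> (1 + u\<^sub>m + u\<^sub>n)\<close>. It evaluates the sum of \<open>u\<^sub>m u\<^sub>n\<close> over
  a fixed \<open>m + n\<close>, and, written as \<open>u\<^sub>k (u\<^sub>m - u\<^bsub>m+k\<^esub>) = u\<^bsub>m+k\<^esub> (1 + u\<^sub>m)\<close>, makes the sum over a fixed
  difference telescope.\<close>

lemma lambert_term_mult:
  assumes "norm q < 1" "m > 0" "n > 0"
  shows "lambert_term q m * lambert_term q n = lambert_term q (m + n) * (1 + lambert_term q m + lambert_term q n)"
proof -
  have nz: "1 - q ^ m \<noteq> 0" "1 - q ^ n \<noteq> 0" "1 - q ^ (m + n) \<noteq> 0"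
    using one_minus_power_nonzero[OF assms(1)] assms by auto
  then show ?thesis unfolding lambert_term_def
    by (simp add: divide_simps) (simp add: power_add algebra_simps)
qed

definition lambert_partial_sum :: "complex \<Rightarrow> nat \<Rightarrow> nat \<Rightarrow> complex" where
  "lambert_partial_sum q k N = (\<Sum>n\<le>N. of_nat n ^ k * lambert_term q n)"

lemma lambert_partial_sum_tendsto:
  assumes "norm q < 1"
  shows "lambert_partial_sum q k \<longlonglongrightarrow> lambert k q"
  using lambert_sums[OF assms, of k] unfolding sums_def_le lambert_partial_sum_def .

definition gap_sum :: "complex \<Rightarrow> nat \<Rightarrow> complex" where
  "gap_sum q n = (\<Sum>m<n. of_nat (n - m) ^ 2 * lambert_term q m)"

text \<open>\<open>\<Sum>\<^bsub>m,n\<^esub> (m - n)\<^sup>2 u\<^sub>m u\<^sub>n\<close> counts each pair \<open>m < n\<close> twice; expanding the square gives the right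
  side.\<close>

lemma gap_sum_symmetric:
  "(\<Sum>n\<le>M. lambert_term q n * gap_sum q n) = lambert_partial_sum q 2 M * lambert_partial_sum q 0 M - lambert_partial_sum q 1 M ^ 2"
proof (induction M)
  case 0
  then show ?case by (simp add: lambert_partial_sum_def gap_sum_def)
next
  case (Suc M)
  have "gap_sum q (Suc M) = (\<Sum>m\<le>M. (of_nat (Suc M) - of_nat m) ^ 2 * lambert_term q m)"
    unfolding gap_sum_def lessThan_Suc_atMost by (intro sum.cong) (auto simp: of_nat_diff)
  also have "\<dots> = of_nat (Suc M) ^ 2 * lambert_partial_sum q 0 M - 2 * of_nat (Suc M) * lambert_partial_sum q 1 M + lambert_partial_sum q 2 M"
    unfolding lambert_partial_sum_def sum_distrib_left sum_subtractf[symmetric] sum.distrib[symmetric]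
    by (intro sum.cong) (auto simp: power2_eq_square algebra_simps)
  finally have w: "gap_sum q (Suc M) = of_nat (Suc M) ^ 2 * lambert_partial_sum q 0 M - 2 * of_nat (Suc M) * lambert_partial_sum q 1 M + lambert_partial_sum q 2 M" .
  have s: "lambert_partial_sum q k (Suc M) = lambert_partial_sum q k M + of_nat (Suc M) ^ k * lambert_term q (Suc M)" for k
    by (simp add: lambert_partial_sum_def)
  show ?case unfolding sum.atMost_Suc Suc.IH w s by (simp add: power2_eq_square algebra_simps)
qed

text \<open>Both sides sum \<open>k\<^sup>2 u\<^bsub>m+k\<^esub> (1 + u\<^sub>m)\<close> over \<open>m, k \<ge> 1\<close> with \<open>m + k \<le> M\<close>: on the left by \<open>n = m + k\<close>, on the
  right by \<open>k\<close>, where the inner sum telescopes.\<close>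

lemma gap_sum_telescope:
  assumes "norm q < 1"
  shows "(\<Sum>n\<le>M. lambert_term q n * (\<Sum>m\<in>{1..<n}. of_nat (n - m) ^ 2 * (1 + lambert_term q m))) =
     (\<Sum>k\<le>M. of_nat k ^ 2 * lambert_term q k * (lambert_partial_sum q 0 (M - k) - lambert_partial_sum q 0 M + lambert_partial_sum q 0 k))"
proof (induction M)
  case 0
  then show ?case by simp
next
  case (Suc M)
  have s: "lambert_partial_sum q 0 (Suc N) = lambert_partial_sum q 0 N + lambert_term q (Suc N)" for N by (simp add: lambert_partial_sum_def)
  have "(\<Sum>k\<le>Suc M. of_nat k ^ 2 * lambert_term q k * (lambert_partial_sum q 0 (Suc M - k) - lambert_partial_sum q 0 (Suc M) + lambert_partial_sum q 0 k)) =
     (\<Sum>k\<le>M. of_nat k ^ 2 * lambert_term q k * (lambert_partial_sum q 0 (Suc M - k) - lambert_partial_sum q 0 (Suc M) + lambert_partial_sum q 0 k))"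
    by (simp add: lambert_partial_sum_def)
  also have "\<dots> = (\<Sum>k\<le>M. of_nat k ^ 2 * lambert_term q k * (lambert_partial_sum q 0 (M - k) - lambert_partial_sum q 0 M + lambert_partial_sum q 0 k)
       + of_nat k ^ 2 * (lambert_term q k * (lambert_term q (Suc M - k) - lambert_term q (Suc M))))"
    by (intro sum.cong) (auto simp: Suc_diff_le s algebra_simps)
  also have "\<dots> = (\<Sum>k\<le>M. of_nat k ^ 2 * lambert_term q k * (lambert_partial_sum q 0 (M - k) - lambert_partial_sum q 0 M + lambert_partial_sum q 0 k))
      + (\<Sum>k\<le>M. of_nat k ^ 2 * (lambert_term q k * (lambert_term q (Suc M - k) - lambert_term q (Suc M))))"
    by (rule sum.distrib)
  also have "(\<Sum>k\<le>M. of_nat k ^ 2 * (lambert_term q k * (lambert_term q (Suc M - k) - lambert_term q (Suc M)))) =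
     (\<Sum>k\<in>{1..<Suc M}. of_nat k ^ 2 * (lambert_term q k * (lambert_term q (Suc M - k) - lambert_term q (Suc M))))"
    by (rule sum.mono_neutral_right) auto
  also have "\<dots> = (\<Sum>k\<in>{1..<Suc M}. of_nat k ^ 2 * (lambert_term q (Suc M) * (1 + lambert_term q (Suc M - k))))"
  proof (intro sum.cong refl)
    fix k assume "k \<in> {1..<Suc M}"
    then show "of_nat k ^ 2 * (lambert_term q k * (lambert_term q (Suc M - k) - lambert_term q (Suc M))) =
        of_nat k ^ 2 * (lambert_term q (Suc M) * (1 + lambert_term q (Suc M - k)))"
      using lambert_term_mult[OF assms, of k "Suc M - k"] by (simp add: algebra_simps)
  qed
  also have "\<dots> = lambert_term q (Suc M) * (\<Sum>m\<in>{1..<Suc M}. of_nat (Suc M - m) ^ 2 * (1 + lambert_term q m))"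
    unfolding sum_distrib_left
    by (rule sum.reindex_bij_witness[of _ "\<lambda>m. Suc M - m" "\<lambda>m. Suc M - m"]) auto
  finally show ?case using Suc.IH by simp
qed

lemma cauchy_grouping:
  assumes "norm q < 1"
  shows "(\<lambda>N. \<Sum>k\<le>N. (of_nat k ^ a * lambert_term q k) * (of_nat (N - k) ^ b * lambert_term q (N - k))) sums (lambert a q * lambert b q)"
  unfolding lambert_def by (rule Cauchy_product_sums[OF lambert_term_norm_summable[OF assms] lambert_term_norm_summable[OF assms]])

lemma sum_squares_complex: "(\<Sum>m\<in>{1..<n}. of_nat (n - m) ^ 2 :: complex) = (2 * of_nat n ^ 3 - 3 * of_nat n ^ 2 + of_nat n) / 6"
proof -
  have "(\<Sum>m\<in>{1..<n}. of_nat (n - m) ^ 2 :: complex) = (\<Sum>m\<in>{1..<n}. of_nat m ^ 2)"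
    by (rule sum.reindex_bij_witness[of _ "\<lambda>m. n - m" "\<lambda>m. n - m"]) auto
  also have "\<dots> = (2 * of_nat n ^ 3 - 3 * of_nat n ^ 2 + of_nat n) / 6"
  proof (induction n)
    case (Suc n)
    show ?case
    proof (cases "n = 0")
      case False
      then show ?thesis using Suc by (simp add: power2_eq_square power3_eq_cube field_simps)
    qed simp
  qed simp
  finally show ?thesis .
qed

text \<open>The boundary terms of the telescoping are the difference between the square and the
  triangular partial sums of a product of two absolutely convergent series.\<close>

lemma telescope_error:
  assumes q: "norm q < 1"
  shows "(\<lambda>M. \<Sum>k\<le>M. of_nat k ^ 2 * lambert_term q k * (lambert_partial_sum q 0 M - lambert_partial_sum q 0 (M - k))) \<longlonglongrightarrow> 0"
proof -
  have eq: "(\<Sum>k\<le>M. of_nat k ^ 2 * lambert_term q k * lambert_partial_sum q 0 (M - k)) =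
    (\<Sum>N\<le>M. \<Sum>k\<le>N. (of_nat k ^ 2 * lambert_term q k) * (of_nat (N - k) ^ 0 * lambert_term q (N - k)))" for M
    unfolding lambert_partial_sum_def sum_distrib_left
    by (subst sum.Sigma, simp, simp, subst sum.Sigma, simp, simp)
       (rule sum.reindex_bij_witness[of _ "\<lambda>(N, k). (k, N - k)" "\<lambda>(k, m). (k + m, k)"], auto)
  have "(\<lambda>M. \<Sum>k\<le>M. of_nat k ^ 2 * lambert_term q k * lambert_partial_sum q 0 (M - k)) \<longlonglongrightarrow> lambert 2 q * lambert 0 q"
    unfolding eq using cauchy_grouping[OF q, of 2 0] unfolding sums_def_le .
  moreover have "(\<lambda>M. lambert_partial_sum q 2 M * lambert_partial_sum q 0 M) \<longlonglongrightarrow> lambert 2 q * lambert 0 q"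
    by (intro tendsto_mult lambert_partial_sum_tendsto q)
  ultimately have "(\<lambda>M. lambert_partial_sum q 2 M * lambert_partial_sum q 0 M - (\<Sum>k\<le>M. of_nat k ^ 2 * lambert_term q k * lambert_partial_sum q 0 (M - k))) \<longlonglongrightarrow>
     lambert 2 q * lambert 0 q - lambert 2 q * lambert 0 q"
    by (intro tendsto_diff)
  moreover have "lambert_partial_sum q 2 M * lambert_partial_sum q 0 M - (\<Sum>k\<le>M. of_nat k ^ 2 * lambert_term q k * lambert_partial_sum q 0 (M - k)) =
     (\<Sum>k\<le>M. of_nat k ^ 2 * lambert_term q k * (lambert_partial_sum q 0 M - lambert_partial_sum q 0 (M - k)))" for M
    unfolding lambert_partial_sum_def[of q 2] sum_distrib_right sum_subtractf[symmetric] by (simp add: right_diff_distrib)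
  ultimately show ?thesis by simp
qed

text \<open>Ramanujan's equation \<open>12 q E\<^sub>2' = E\<^sub>2\<^sup>2 - E\<^sub>4\<close> in terms of Lambert series. Writing
  \<open>4mn = (m + n)\<^sup>2 - (m - n)\<^sup>2\<close> in \<open>(\<Sum> n u\<^sub>n)\<^sup>2\<close>, the first square is summed over fixed \<open>m + n\<close> and the second
  over fixed \<open>|m - n|\<close>. Each produces a multiple of \<open>\<Sum> n\<^sup>2 u\<^sub>n (u\<^sub>1 + \<dots> + u\<^sub>n)\<close>, and these cancel; the rest are
  simple sums.\<close>

theorem lambert_1_square:
  assumes q: "norm q < 1" "q \<noteq> 0"
  shows "12 * lambert 1 q ^ 2 = 5 * lambert 3 q + lambert 1 q - 6 * (q * deriv (lambert 1) q)"
proof -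
  define S where "S = (\<lambda>k. lambert k q)"
  define t where "t = (\<lambda>n. of_nat n ^ 2 * lambert_term q n * lambert_partial_sum q 0 n)"
  define p :: "nat \<Rightarrow> complex" where "p = (\<lambda>n. (2 * of_nat n ^ 3 - 3 * of_nat n ^ 2 + of_nat n) / 6)"
  have w: "(\<lambda>n. lambert_term q n * gap_sum q n) sums (S 2 * S 0 - S 1 ^ 2)"
    unfolding sums_def_le gap_sum_symmetric S_def by (intro tendsto_intros lambert_partial_sum_tendsto q)
  have pw: "lambert_term q n * (\<Sum>m\<in>{1..<n}. of_nat (n - m) ^ 2 * (1 + lambert_term q m)) = lambert_term q n * (p n + gap_sum q n)" for n
  proof -
    have "(\<Sum>m\<in>{1..<n}. of_nat (n - m) ^ 2 * lambert_term q m) = gap_sum q n"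
      unfolding gap_sum_def by (rule sum.mono_neutral_left) (auto simp: not_le)
    then show ?thesis unfolding p_def sum_squares_complex[symmetric] by (simp add: algebra_simps sum.distrib)
  qed
  have "(\<Sum>n\<le>M. t n - lambert_term q n * (p n + gap_sum q n)) = (\<Sum>k\<le>M. of_nat k ^ 2 * lambert_term q k * (lambert_partial_sum q 0 M - lambert_partial_sum q 0 (M - k)))" for M
    unfolding pw[symmetric] sum_subtractf gap_sum_telescope[OF q(1)]
    unfolding sum_subtractf[symmetric] t_def by (intro sum.cong) (auto simp: algebra_simps)
  then have "(\<lambda>n. t n - lambert_term q n * (p n + gap_sum q n)) sums 0"
    unfolding sums_def_le using telescope_error[OF q(1)] by simp
  from sums_add[OF this w] have tp: "(\<lambda>n. t n - lambert_term q n * p n) sums (S 2 * S 0 - S 1 ^ 2)"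
    by (simp add: algebra_simps)
  have c: "(\<Sum>k\<le>N. (of_nat k ^ 2 * lambert_term q k) * (of_nat (N - k) ^ 0 * lambert_term q (N - k))) +
       2 * (\<Sum>k\<le>N. (of_nat k ^ 1 * lambert_term q k) * (of_nat (N - k) ^ 1 * lambert_term q (N - k))) +
       (\<Sum>k\<le>N. (of_nat k ^ 0 * lambert_term q k) * (of_nat (N - k) ^ 2 * lambert_term q (N - k))) =
       of_nat N ^ 2 * lambert_term q N * (of_nat N - 1) + 2 * t N - 2 * (of_nat N ^ 2 * lambert_term q N ^ 2)" (is "?L = ?R") for N
  proof (cases "N = 0")
    case False
    have "?L = (\<Sum>k\<le>N. of_nat N ^ 2 * (lambert_term q k * lambert_term q (N - k)))"
      unfolding sum_distrib_left sum.distrib[symmetric]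
      by (intro sum.cong) (auto simp: of_nat_diff power2_eq_square algebra_simps)
    also have "\<dots> = (\<Sum>k\<in>{1..<N}. of_nat N ^ 2 * (lambert_term q k * lambert_term q (N - k)))"
    proof (rule sum.mono_neutral_right)
      show "\<forall>k\<in>{..N} - {1..<N}. of_nat N ^ 2 * (lambert_term q k * lambert_term q (N - k)) = 0"
      proof
        fix k assume "k \<in> {..N} - {1..<N}"
        then have "k = 0 \<or> k = N" by auto
        then show "of_nat N ^ 2 * (lambert_term q k * lambert_term q (N - k)) = 0" by auto
      qed
    qed auto
    also have "\<dots> = (\<Sum>k\<in>{1..<N}. of_nat N ^ 2 * (lambert_term q N * (1 + lambert_term q k + lambert_term q (N - k))))"
      using lambert_term_mult[OF q(1)] by (intro sum.cong) auto
    also have "\<dots> = of_nat N ^ 2 * lambert_term q N * ((\<Sum>k\<in>{1..<N}. 1) + (\<Sum>k\<in>{1..<N}. lambert_term q k) + (\<Sum>k\<in>{1..<N}. lambert_term q (N - k)))"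
      unfolding sum.distrib[symmetric] sum_distrib_left by (simp add: mult_ac)
    also have "(\<Sum>k\<in>{1..<N}. lambert_term q (N - k)) = (\<Sum>k\<in>{1..<N}. lambert_term q k)"
      by (rule sum.reindex_bij_witness[of _ "\<lambda>m. N - m" "\<lambda>m. N - m"]) auto
    also have "(\<Sum>k\<in>{1..<N}. 1) = (of_nat N - 1 :: complex)" using False by (simp add: of_nat_diff)
    also have "(\<Sum>k\<in>{1..<N}. lambert_term q k) = lambert_partial_sum q 0 N - lambert_term q N"
    proof -
      have "lambert_partial_sum q 0 N = (\<Sum>k\<in>insert N {1..<N}. lambert_term q k)"
        unfolding lambert_partial_sum_def
      proof (rule sum.mono_neutral_cong_right)
        show "\<forall>k\<in>{..N} - insert N {1..<N}. of_nat k ^ 0 * lambert_term q k = 0"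
        proof
          fix k assume "k \<in> {..N} - insert N {1..<N}"
          then have "k = 0" by auto
          then show "of_nat k ^ 0 * lambert_term q k = 0" by simp
        qed
      qed (use False in auto)
      then show ?thesis by simp
    qed
    finally show ?thesis by (simp add: t_def power2_eq_square algebra_simps)
  qed (simp add: t_def)
  have "(\<lambda>N. of_nat N ^ 2 * lambert_term q N * (of_nat N - 1) + 2 * t N - 2 * (of_nat N ^ 2 * lambert_term q N ^ 2)) sums
      (S 2 * S 0 + 2 * (S 1 * S 1) + S 0 * S 2)"
    unfolding c[symmetric] S_def by (intro sums_add sums_mult cauchy_grouping q)
  from sums_diff[OF this sums_mult[OF tp, of 2]]
  have "(\<lambda>N. of_nat N ^ 2 * lambert_term q N * (of_nat N - 1) + 2 * (lambert_term q N * p N) - 2 * (of_nat N ^ 2 * lambert_term q N ^ 2)) sums (4 * S 1 ^ 2)"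
    by (simp add: algebra_simps power2_eq_square)
  moreover have "(\<lambda>N. 5 / 3 * (of_nat N ^ 3 * lambert_term q N) + 1 / 3 * (of_nat N ^ 1 * lambert_term q N)
       - 2 * (of_nat N ^ 2 * lambert_term q N * (1 + lambert_term q N))) sums (5 / 3 * S 3 + 1 / 3 * S 1 - 2 * (q * deriv (lambert 1) q))"
    unfolding S_def by (intro sums_add sums_diff sums_mult lambert_sums lambert_1_derivative q)
  moreover have "of_nat N ^ 2 * lambert_term q N * (of_nat N - 1) + 2 * (lambert_term q N * p N) - 2 * (of_nat N ^ 2 * lambert_term q N ^ 2) =
      5 / 3 * (of_nat N ^ 3 * lambert_term q N) + 1 / 3 * (of_nat N ^ 1 * lambert_term q N)
       - 2 * (of_nat N ^ 2 * lambert_term q N * (1 + lambert_term q N))" for N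
    by (simp add: p_def power2_eq_square power3_eq_cube field_simps)
  ultimately have "4 * S 1 ^ 2 = 5 / 3 * S 3 + 1 / 3 * S 1 - 2 * (q * deriv (lambert 1) q)"
    using sums_unique2 by simp
  then have "3 * (4 * S 1 ^ 2) = 3 * (5 / 3 * S 3 + 1 / 3 * S 1 - 2 * (q * deriv (lambert 1) q))" by simp
  then show ?thesis by (simp add: S_def)
qed

section \<open>Logarithmic derivatives of eta quotients\<close>

lemma euler_uniform_limit:
  assumes "r < 1" "0 \<le> r"
  shows "uniform_limit (cball 0 r) (\<lambda>N q. \<Prod>n<N. 1 - q ^ Suc n) euler sequentially"
proof -
  have "uniformly_convergent_on (cball 0 r) (\<lambda>N q :: complex. \<Sum>n<N. norm (1 - q ^ Suc n - 1))"
  proof (rule Weierstrass_m_test')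
    show "norm (norm (1 - q ^ Suc n - 1)) \<le> r * r ^ n" if "q \<in> cball 0 r" for q :: complex and n
      using power_mono[of "norm q" r "Suc n"] that by (simp add: norm_mult norm_power)
    show "summable (\<lambda>n. r * r ^ n)"
      using assms by (simp add: summable_mult summable_geometric)
  qed
  then have "uniformly_convergent_on (cball 0 r) (\<lambda>N q :: complex. \<Prod>n<N. 1 - q ^ Suc n)"
    by (intro uniformly_convergent_on_prod' continuous_intros) auto
  then have *: "uniform_limit (cball 0 r) (\<lambda>N q :: complex. \<Prod>n<N. 1 - q ^ Suc n) (\<lambda>q. lim (\<lambda>N. \<Prod>n<N. 1 - q ^ Suc n)) sequentially"
    by (simp only: uniformly_convergent_uniform_limit_iff)
  have "lim (\<lambda>N. \<Prod>n<N. 1 - q ^ Suc n) = euler q" if "q \<in> cball 0 r" for q :: complex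
    using q_pochhammer_tendsto[of q q] that assms by (intro limI) (auto simp: euler_def)
  with * show ?thesis by (subst (asm) uniform_limit_cong'[where g = "\<lambda>N q. \<Prod>n<N. 1 - q ^ Suc n" and i = euler]) auto
qed

lemma euler_holomorphic: "euler holomorphic_on ball 0 1"
proof (rule holomorphic_uniform_sequence)
  show "(\<lambda>q. \<Prod>n<N. 1 - q ^ Suc n) holomorphic_on ball 0 1" for N
    by (intro holomorphic_intros)
  show "\<exists>d>0. cball x d \<subseteq> ball 0 1 \<and> uniform_limit (cball x d) (\<lambda>N q. \<Prod>n<N. 1 - q ^ Suc n) euler sequentially"
    if x: "x \<in> ball 0 1" for x
  proof -
    obtain d r where "d > 0" "r < 1" "0 \<le> r" "cball x d \<subseteq> cball 0 r" "cball x d \<subseteq> ball 0 1"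
      using cball_in_unit_ball[OF x] .
    then show ?thesis using uniform_limit_on_subset[OF euler_uniform_limit] by blast
  qed
qed auto

lemma euler_0 [simp]: "euler 0 = 1"
  by (simp add: euler_def)

lemma euler_logderiv:
  assumes "norm q < 1"
  shows "q * (deriv euler q / euler q) = - lambert 1 q"
proof -
  obtain r where r: "norm q < r" "r < 1" using dense assms by blast
  have r0: "0 \<le> r" using r(1) norm_ge_zero[of q] by linarith
  have "(\<lambda>n. deriv (\<lambda>q. 1 - q ^ Suc n) q / (1 - q ^ Suc n)) sums (deriv euler q / euler q)"
  proof (rule logderiv_prodinf_complex_uniform_limit)
    show "uniform_limit (ball 0 r) (\<lambda>N q. \<Prod>n<N. 1 - q ^ Suc n) euler sequentially"
      by (rule uniform_limit_on_subset[OF euler_uniform_limit[OF r(2) r0]]) auto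
    show "(\<lambda>q. 1 - q ^ Suc n) holomorphic_on ball 0 r" for n by (intro holomorphic_intros)
  qed (use r assms in \<open>auto simp: euler_nonzero\<close>)
  moreover have "deriv (\<lambda>q. 1 - q ^ Suc n) q = - (of_nat (Suc n) * q ^ n)" for n
    by (rule DERIV_imp_deriv) (auto intro!: derivative_eq_intros simp del: power_Suc)
  ultimately have "(\<lambda>n. - (of_nat (Suc n) * q ^ n) / (1 - q ^ Suc n)) sums (deriv euler q / euler q)"
    by simp
  then have "(\<lambda>n. (- q) * (- (of_nat (Suc n) * q ^ n) / (1 - q ^ Suc n))) sums ((- q) * (deriv euler q / euler q))"
    by (rule sums_mult)
  moreover have "(- q) * (- (of_nat (Suc n) * q ^ n) / (1 - q ^ Suc n)) = of_nat (Suc n) ^ 1 * lambert_term q (Suc n)" for n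
    by (simp add: lambert_term_def mult_ac)
  ultimately have "(\<lambda>n. of_nat (Suc n) ^ 1 * lambert_term q (Suc n)) sums ((- q) * (deriv euler q / euler q))"
    by (simp only:)
  then have "(\<lambda>n. of_nat n ^ 1 * lambert_term q n) sums ((- q) * (deriv euler q / euler q))"
    by (subst (asm) sums_Suc_iff) simp
  then have "(- q) * (deriv euler q / euler q) = lambert 1 q"
    using lambert_sums[OF assms, of 1] sums_unique2 by blast
  then show ?thesis by (simp add: minus_equation_iff[of _ "lambert 1 q"] eq_commute)
qed

definition eisen2 :: "complex \<Rightarrow> complex" where "eisen2 q = 1 - 24 * lambert 1 q"
definition eisen4 :: "complex \<Rightarrow> complex" where "eisen4 q = 1 + 240 * lambert 3 q"

lemma eisen_holomorphic: "eisen2 holomorphic_on ball 0 1" "eisen4 holomorphic_on ball 0 1"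
  unfolding eisen2_def eisen4_def by (intro holomorphic_intros lambert_holomorphic)+

lemma eisen_0 [simp]: "eisen2 0 = 1" "eisen4 0 = 1"
  by (simp_all add: eisen2_def eisen4_def)

lemma eisen2_derivative:
  assumes "norm q < 1" "q \<noteq> 0"
  shows "(eisen2 has_field_derivative (eisen2 q ^ 2 - eisen4 q) / 12 / q) (at q)"
proof -
  have d: "(lambert 1 has_field_derivative deriv (lambert 1) q) (at q)"
    using lambert_holomorphic assms by (intro holomorphic_derivI[of _ "ball 0 1"]) auto
  have "(eisen2 has_field_derivative - 24 * deriv (lambert 1) q) (at q)"
    unfolding eisen2_def by (rule derivative_eq_intros d refl)+ simp
  moreover have "- 24 * deriv (lambert 1) q = (eisen2 q ^ 2 - eisen4 q) / 12 / q"
  proof -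
    have "12 * (q * (- 24 * deriv (lambert 1) q)) = eisen2 q ^ 2 - eisen4 q"
      using lambert_1_square[OF assms] unfolding eisen2_def eisen4_def by algebra
    then show ?thesis using assms by (simp add: field_simps)
  qed
  ultimately show ?thesis by simp
qed

text \<open>The logarithmic derivative \<open>q f'(q)/f(q)\<close> equals \<open>l\<close>. With the operator \<open>q d/dq\<close> all
  logarithmic derivatives of eta quotients are combinations of \<open>E\<^sub>2\<close> at powers of \<open>q\<close>.\<close>

definition has_qlogderiv :: "(complex \<Rightarrow> complex) \<Rightarrow> complex \<Rightarrow> complex \<Rightarrow> bool" where
  "has_qlogderiv f l q \<longleftrightarrow> f q \<noteq> 0 \<and> (f has_field_derivative f q * l / q) (at q)"

lemma has_qlogderiv_mult:
  "has_qlogderiv f l q \<Longrightarrow> has_qlogderiv g m q \<Longrightarrow> has_qlogderiv (\<lambda>q. f q * g q) (l + m) q"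
  unfolding has_qlogderiv_def
  by (auto intro!: derivative_eq_intros simp: add_divide_distrib algebra_simps)

lemma has_qlogderiv_inverse:
  "has_qlogderiv f l q \<Longrightarrow> has_qlogderiv (\<lambda>q. inverse (f q)) (- l) q"
  unfolding has_qlogderiv_def
  by (auto intro!: derivative_eq_intros simp: field_simps)

lemma has_qlogderiv_divide:
  "has_qlogderiv f l q \<Longrightarrow> has_qlogderiv g m q \<Longrightarrow> has_qlogderiv (\<lambda>q. f q / g q) (l - m) q"
  using has_qlogderiv_mult[OF _ has_qlogderiv_inverse, of f l q g m] by (simp add: divide_inverse)

lemma has_qlogderiv_power:
  "has_qlogderiv f l q \<Longrightarrow> has_qlogderiv (\<lambda>q. f q ^ n) (of_nat n * l) q"
proof (induction n)
  case 0
  then show ?case by (simp add: has_qlogderiv_def)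
next
  case (Suc n)
  then show ?case using has_qlogderiv_mult[OF Suc.prems Suc.IH] by (simp add: algebra_simps)
qed

lemma has_qlogderiv_id: "q \<noteq> 0 \<Longrightarrow> has_qlogderiv (\<lambda>q. q) 1 q"
  by (simp add: has_qlogderiv_def)

lemma has_qlogderiv_unique:
  "has_qlogderiv f l q \<Longrightarrow> has_qlogderiv f m q \<Longrightarrow> q \<noteq> 0 \<Longrightarrow> l = m"
  unfolding has_qlogderiv_def by (auto dest: DERIV_unique)

lemma qderiv_compose_power:
  assumes "(f has_field_derivative c / q ^ k) (at (q ^ k))" "q \<noteq> 0" "k > 0"
  shows "((\<lambda>q. f (q ^ k)) has_field_derivative of_nat k * c / q) (at q)"
proof -
  have "((\<lambda>q. q ^ k) has_field_derivative of_nat k * q ^ (k - 1)) (at q)"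
    by (auto intro!: derivative_eq_intros)
  from DERIV_chain2[OF assms(1) this]
  have "((\<lambda>q. f (q ^ k)) has_field_derivative c / q ^ k * (of_nat k * q ^ (k - 1))) (at q)" .
  moreover have "c / q ^ k * (of_nat k * q ^ (k - 1)) = of_nat k * c / q"
    using assms(2,3) by (cases k) auto
  ultimately show ?thesis by (simp only:)
qed

lemma has_qlogderiv_euler_power:
  assumes "norm q < 1" "q \<noteq> 0" "k > 0"
  shows "has_qlogderiv (\<lambda>q. euler (q ^ k)) (of_nat k * ((eisen2 (q ^ k) - 1) / 24)) q"
proof -
  have qk: "norm (q ^ k) < 1" "q ^ k \<noteq> 0" using norm_power_less_one assms by auto
  have nz: "euler (q ^ k) \<noteq> 0" using euler_nonzero qk by blast
  have "(euler has_field_derivative deriv euler (q ^ k)) (at (q ^ k))"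
    using euler_holomorphic qk by (intro holomorphic_derivI[of _ "ball 0 1"]) auto
  moreover have "deriv euler (q ^ k) = (euler (q ^ k) * ((eisen2 (q ^ k) - 1) / 24)) / q ^ k"
    using euler_logderiv[OF qk(1)] qk nz by (simp add: eisen2_def field_simps)
  ultimately have "(euler has_field_derivative (euler (q ^ k) * ((eisen2 (q ^ k) - 1) / 24)) / q ^ k) (at (q ^ k))" by simp
  from qderiv_compose_power[OF this assms(2,3)] show ?thesis
    using nz by (simp add: has_qlogderiv_def mult_ac)
qed

section \<open>A rigidity principle for \<open>q \<mapsto> q\<^sup>2\<close>\<close>

text \<open>If \<open>N(q) = q\<^sup>n G(q)\<close> with \<open>G(0) \<noteq> 0\<close> and \<open>n > 0\<close>, the equation becomes
  \<open>G(q) A(q) = q\<^sup>n G(q\<^sup>2) M(q)\<close>, and \<open>q \<rightarrow> 0\<close> gives \<open>G(0) A(0) = 0\<close>.\<close>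

lemma square_functional_equation:
  assumes holo: "N holomorphic_on ball 0 1" and cont: "isCont A 0" "isCont M 0"
    and "A 0 \<noteq> 0" "N 0 = 0"
    and eq: "\<And>q. norm q < 1 \<Longrightarrow> q \<noteq> 0 \<Longrightarrow> N q * A q = N (q\<^sup>2) * M q"
    and q: "norm q < 1"
  shows "N q = (0 :: complex)"
proof (rule ccontr)
  assume "N q \<noteq> 0"
  then have nonconst: "\<not> N constant_on ball 0 1"
    using q \<open>N 0 = 0\<close> unfolding constant_on_def
    by (metis centre_in_ball dist_0_norm mem_ball zero_less_one)
  have "(0 :: complex) \<in> ball 0 1" by simp
  then show False
  proof (rule holomorphic_factor_zero_nonconstant[OF holo open_ball connected_ball _ \<open>N 0 = 0\<close> nonconst])
    fix g :: "complex \<Rightarrow> complex" and r :: real and n :: nat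
    assume g: "0 < n" "0 < r" "ball (0 :: complex) r \<subseteq> ball 0 1" "g holomorphic_on ball 0 r"
        "\<And>w. w \<in> ball 0 r \<Longrightarrow> N w = (w - 0) ^ n * g w" "\<And>w. w \<in> ball 0 r \<Longrightarrow> g w \<noteq> 0"
    have r1: "r \<le> 1" using g(2,3) by (simp add: ball_subset_ball_iff)
    have cg: "isCont g 0"
      using g(2,4) holomorphic_on_imp_continuous_on continuous_on_interior[of "ball 0 r" g 0] by auto
    have "eventually (\<lambda>w. w \<in> ball 0 r - {0}) (at (0 :: complex))"
      using g(2) by (intro eventually_at_in_open) auto
    then have ev: "eventually (\<lambda>w. g w * A w = w ^ n * g (w\<^sup>2) * M w) (at 0)"
    proof eventually_elim
      case (elim w)
      then have w: "norm w < r" "w \<noteq> 0" by auto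
      have "norm (w\<^sup>2) \<le> norm w * 1" using w r1 unfolding power2_eq_square norm_mult by (intro mult_left_mono) auto
      then have w2: "w\<^sup>2 \<in> ball 0 r" using w by simp
      have "w ^ n * g w * A w = (w\<^sup>2) ^ n * g (w\<^sup>2) * M w"
        using eq[of w] g(5)[of w] g(5)[OF w2] w r1 by auto
      then have "w ^ n * (g w * A w) = w ^ n * (w ^ n * g (w\<^sup>2) * M w)"
        by (simp add: power2_eq_square power_mult_distrib mult_ac)
      then show ?case using w by simp
    qed
    have c2: "isCont (\<lambda>w. g (w\<^sup>2)) 0"
      by (rule isCont_o2[where f = "\<lambda>w. w\<^sup>2" and g = g]) (use cg in \<open>auto intro!: continuous_intros\<close>)
    have "((\<lambda>w. g w * A w) \<longlongrightarrow> g 0 * A 0) (at 0)"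
      using cg cont by (intro tendsto_intros) (auto simp: isCont_def)
    moreover have "((\<lambda>w. w ^ n * g (w\<^sup>2) * M w) \<longlongrightarrow> 0 ^ n * g (0\<^sup>2) * M 0) (at 0)"
      using c2 cont by (intro tendsto_intros) (auto simp: isCont_def)
    moreover have "((\<lambda>w. w ^ n * g (w\<^sup>2) * M w) \<longlongrightarrow> g 0 * A 0) (at 0)"
      using Lim_transform_eventually[OF calculation(1) ev] .
    ultimately have "g 0 * A 0 = 0 ^ n * g (0\<^sup>2) * M 0"
      using LIM_unique by blast
    then show False using g(1,2,6) \<open>A 0 \<noteq> 0\<close> by auto
  qed
qed

section \<open>The Hauptmodul of level six\<close>

text \<open>The evaluations of \<open>a(q) + 2a(q\<^sup>2)\<close> and \<open>a(q) - a(q\<^sup>2)\<close> are \<open>3g\<close> and \<open>6gw\<close>, which determines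
  \<open>a(q)\<close> and \<open>a(q\<^sup>2)\<close>. The other two evaluations then read \<open>g (1 - 8w)\<close> and \<open>2g (1 + w)\<close>.\<close>

lemma level6_relations:
  fixes q :: complex
  assumes q: "norm q < 1" "q \<noteq> 0"
  defines "P1 \<equiv> euler q" and "P2 \<equiv> euler (q\<^sup>2)" and "P3 \<equiv> euler (q ^ 3)" and "P6 \<equiv> euler (q ^ 6)"
  defines "g \<equiv> level6_form q" and "w \<equiv> hauptmodul6 q"
  shows "1 - 8 * w = P1 ^ 8 * P6 ^ 4 / (P3 ^ 8 * P2 ^ 4)" (is ?A)
    and "1 + w = P2 ^ 5 * P6 / (P1 * P3 ^ 5)" (is ?B)
    and "cubic_a q = g * (1 + 4 * w)" (is ?C)
    and "cubic_a (q\<^sup>2) = g * (1 - 2 * w)" (is ?D)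
proof -
  have nz: "P1 \<noteq> 0" "P2 \<noteq> 0" "P3 \<noteq> 0" "P6 \<noteq> 0"
    using norm_power_less_one[OF q(1)] q by (auto simp: P1_def P2_def P3_def P6_def intro!: euler_nonzero)
  note v = cubic_a_values[OF q, folded P1_def P2_def P3_def P6_def]
  have g: "g = P3 ^ 6 * P2 / (P1 ^ 2 * P6 ^ 3)"
    by (simp add: g_def level6_form_def P1_def P2_def P3_def P6_def)
  have w: "w = q * (P1 * P6 ^ 3 / (P2 * P3 ^ 3)) ^ 3"
    by (simp add: w_def hauptmodul6_def P1_def P2_def P3_def P6_def)
  have gnz: "g \<noteq> 0" using nz by (simp add: g)
  have gw: "6 * g * w = 6 * q * P6 ^ 6 * P1 / (P2 ^ 2 * P3 ^ 3)"
  proof -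
    have "6 * g * w = (6 * (P3 ^ 6 * P2) * (q * (P1 * P6 ^ 3) ^ 3)) / (P1\<^sup>2 * P6 ^ 3 * (P2 * P3 ^ 3) ^ 3)"
      by (simp add: g w power_divide)
    also have "\<dots> = 6 * q * P6 ^ 6 * P1 / (P2 ^ 2 * P3 ^ 3)"
      by (subst frac_eq_eq) (use nz in simp, use nz in simp, algebra)
    finally show ?thesis .
  qed
  have r1: "cubic_a q + 2 * cubic_a (q\<^sup>2) = 3 * g" using v(3) by (simp add: g)
  have r2: "cubic_a q - cubic_a (q\<^sup>2) = 6 * g * w" using v(4) gw by simp
  have "3 * cubic_a q = 3 * (g * (1 + 4 * w))" using r1 r2 by algebra
  then show C: ?C by simp
  have "3 * cubic_a (q\<^sup>2) = 3 * (g * (1 - 2 * w))" using r1 r2 by algebra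
  then show D: ?D by simp
  have "g * (1 - 8 * w) = P1 ^ 6 * P6 / (P3 ^ 2 * P2 ^ 3)"
    unfolding v(1)[symmetric] C D by algebra
  also have "\<dots> = g * (P1 ^ 8 * P6 ^ 4 / (P3 ^ 8 * P2 ^ 4))"
    unfolding g times_divide_times_eq
    by (subst frac_eq_eq) (use nz in simp, use nz in simp, algebra)
  finally show ?A using gnz by (simp only: mult_cancel_left) simp
  have "2 * g * (1 + w) = 2 * P2 ^ 6 * P3 / (P6 ^ 2 * P1 ^ 3)"
    unfolding v(2)[symmetric] C D by algebra
  also have "\<dots> = 2 * g * (P2 ^ 5 * P6 / (P1 * P3 ^ 5))"
    unfolding g times_divide_eq_right times_divide_eq_left divide_divide_eq_left
    by (subst frac_eq_eq) (use nz in simp, use nz in simp, algebra)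
  finally show ?B using gnz by (simp only: mult_cancel_left) simp
qed

lemma euler_power_nonzero:
  assumes "norm q < 1" "k > 0"
  shows "euler (q ^ k) \<noteq> 0"
  by (rule euler_nonzero[OF norm_power_less_one[OF assms]])

lemma level6_nonzero:
  assumes q: "norm q < 1" "q \<noteq> 0"
  shows "level6_form q \<noteq> 0" "hauptmodul6 q \<noteq> 0" "1 - 8 * hauptmodul6 q \<noteq> 0" "1 + hauptmodul6 q \<noteq> 0"
proof -
  have nz: "euler q \<noteq> 0" "euler (q\<^sup>2) \<noteq> 0" "euler (q ^ 3) \<noteq> 0" "euler (q ^ 6) \<noteq> 0"
    using euler_nonzero[OF q(1)] euler_power_nonzero[OF q(1)] by simp_all
  show "level6_form q \<noteq> 0" "hauptmodul6 q \<noteq> 0" using nz q by (simp_all add: level6_form_def hauptmodul6_def)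
  show "1 - 8 * hauptmodul6 q \<noteq> 0" unfolding level6_relations(1)[OF q] using nz by simp
  show "1 + hauptmodul6 q \<noteq> 0" unfolding level6_relations(2)[OF q] using nz by simp
qed

lemma level6_holomorphic: "level6_form holomorphic_on ball 0 1" "hauptmodul6 holomorphic_on ball 0 1"
proof -
  have sub: "(\<lambda>q. euler (q ^ k)) holomorphic_on ball 0 1" if "k > 0" for k
    by (rule holomorphic_on_compose_gen[OF _ euler_holomorphic, of "\<lambda>q. q ^ k", unfolded o_def])
       (use norm_power_less_one that in \<open>auto intro!: holomorphic_intros\<close>)
  have nz: "euler q \<noteq> 0" "euler (q\<^sup>2) \<noteq> 0" "euler (q ^ 3) \<noteq> 0" "euler (q ^ 6) \<noteq> 0" if "norm q < 1" for q
    using euler_nonzero[OF that(1)] euler_power_nonzero[OF that(1)] by simp_all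
  show "level6_form holomorphic_on ball 0 1" unfolding level6_form_def
    by (intro holomorphic_on_mult holomorphic_on_divide holomorphic_on_power holomorphic_on_ident euler_holomorphic sub)
       (use nz in simp_all)
  show "hauptmodul6 holomorphic_on ball 0 1" unfolding hauptmodul6_def
    by (intro holomorphic_on_mult holomorphic_on_divide holomorphic_on_power holomorphic_on_ident euler_holomorphic sub)
       (use nz in simp_all)
qed

lemma level6_0 [simp]: "level6_form 0 = 1" "hauptmodul6 0 = 0"
  by (simp_all add: level6_form_def hauptmodul6_def)

definition scaled_eisen2 :: "nat \<Rightarrow> complex \<Rightarrow> complex" where
  "scaled_eisen2 d q = of_nat d * eisen2 (q ^ d)"

lemma has_qlogderiv_euler:
  assumes "norm q < 1" "q \<noteq> 0" "k > 0"
  shows "has_qlogderiv (\<lambda>q. euler (q ^ k)) ((scaled_eisen2 k q - of_nat k) / 24) q"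
  using has_qlogderiv_euler_power[OF assms] by (simp add: scaled_eisen2_def field_simps)

lemma has_qlogderiv_level6:
  assumes q: "norm q < 1" "q \<noteq> 0"
  defines "e \<equiv> (\<lambda>d. scaled_eisen2 d q)"
  shows "has_qlogderiv level6_form ((6 * e 3 + e 2 - 2 * e 1 - 3 * e 6) / 24) q" (is ?G)
    and "has_qlogderiv hauptmodul6 ((e 1 + 3 * e 6 - e 2 - 3 * e 3) / 8) q" (is ?W)
    and "has_qlogderiv (\<lambda>q. 1 - 8 * hauptmodul6 q) ((2 * e 1 + e 6 - 2 * e 3 - e 2) / 6) q" (is ?A)
    and "has_qlogderiv (\<lambda>q. 1 + hauptmodul6 q) ((5 * e 2 + e 6 - e 1 - 5 * e 3) / 24) q" (is ?B)
proof -
  have u: "has_qlogderiv euler ((e 1 - 1) / 24) q" "has_qlogderiv (\<lambda>q. euler (q\<^sup>2)) ((e 2 - 2) / 24) q"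
    "has_qlogderiv (\<lambda>q. euler (q ^ 3)) ((e 3 - 3) / 24) q" "has_qlogderiv (\<lambda>q. euler (q ^ 6)) ((e 6 - 6) / 24) q"
    using has_qlogderiv_euler[OF q, of 1] has_qlogderiv_euler[OF q, of 2] has_qlogderiv_euler[OF q, of 3] has_qlogderiv_euler[OF q, of 6]
    by (simp_all add: e_def)
  note rules = has_qlogderiv_mult has_qlogderiv_divide has_qlogderiv_power has_qlogderiv_id u
  have conv: "has_qlogderiv f m q" if "has_qlogderiv f l q" "l = m" for f l m using that by simp
  show ?G unfolding level6_form_def by (rule conv, (rule rules q)+) (simp add: field_simps)
  show ?W unfolding hauptmodul6_def by (rule conv, (rule rules q)+) (simp add: field_simps)
  have cong: "has_qlogderiv f l q" if "has_qlogderiv h l q" "\<And>p. norm p < 1 \<Longrightarrow> p \<noteq> 0 \<Longrightarrow> f p = h p" for f h l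
  proof -
    have "eventually (\<lambda>p. p \<in> ball 0 1 - {0}) (nhds q)"
      by (rule eventually_nhds_in_open) (use q in auto)
    then have "eventually (\<lambda>p. h p = f p) (nhds q)" by eventually_elim (use that(2) in auto)
    then have "(f has_field_derivative h q * l / q) (at q)"
      using DERIV_cong_ev[OF refl _ refl, of h f q "h q * l / q"] that(1) unfolding has_qlogderiv_def by simp
    then show ?thesis
      using that(1) that(2)[OF q] unfolding has_qlogderiv_def by simp
  qed
  have "has_qlogderiv (\<lambda>q. euler q ^ 8 * euler (q ^ 6) ^ 4 / (euler (q ^ 3) ^ 8 * euler (q\<^sup>2) ^ 4)) ((2 * e 1 + e 6 - 2 * e 3 - e 2) / 6) q"
    by (rule conv, (rule rules)+) (simp add: field_simps)
  then show ?A by (rule cong) (use level6_relations(1) in auto)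
  have "has_qlogderiv (\<lambda>q. euler (q\<^sup>2) ^ 5 * euler (q ^ 6) / (euler q * euler (q ^ 3) ^ 5)) ((5 * e 2 + e 6 - e 1 - 5 * e 3) / 24) q"
    by (rule conv, (rule rules)+) (simp add: field_simps)
  then show ?B by (rule cong) (use level6_relations(2) in auto)
qed

section \<open>Eisenstein series of weight two at level six\<close>

lemma has_qlogderiv_affine:
  assumes "has_qlogderiv f d q" "1 + c * f q \<noteq> 0"
  shows "has_qlogderiv (\<lambda>q. 1 + c * f q) (c * f q * d / (1 + c * f q)) q"
  using assms unfolding has_qlogderiv_def by (auto intro!: derivative_eq_intros)

text \<open>If \<open>d\<close> is the logarithmic derivative of \<open>w\<close>, those of \<open>1 - 8w\<close> and \<open>1 + w\<close> are \<open>-8wd/(1 - 8w)\<close> and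
  \<open>wd/(1 + w)\<close>. As all three functions are eta quotients, this gives three linear equations for
  the three independent differences of the \<open>d E\<^sub>2(q\<^sup>d)\<close>, solved here in terms of \<open>d\<close>.\<close>

lemma eisen2_linear_relations:
  fixes q :: complex
  assumes q: "norm q < 1" "q \<noteq> 0"
  defines "w \<equiv> hauptmodul6 q" and "e \<equiv> (\<lambda>d. scaled_eisen2 d q)"
  defines "d \<equiv> (e 1 + 3 * e 6 - e 2 - 3 * e 3) / 8"
  shows "(e 3 - e 1) * ((1 - 8 * w) * (1 + w)) = 2 * (1 + 4 * w)\<^sup>2 * d"
    and "(e 2 - e 1) * ((1 - 8 * w) * (1 + w)) = (1 + 20 * w - 8 * w\<^sup>2) * d"
    and "(e 6 - e 2) * ((1 - 8 * w) * (1 + w)) = 4 * (1 - 2 * w)\<^sup>2 * d"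
proof -
  have e': "e n = scaled_eisen2 n q" for n by (simp add: e_def)
  note L = has_qlogderiv_level6[OF q, folded e']
  note nz = level6_nonzero[OF q, folded w_def]
  have d8: "8 * d = e 1 + 3 * e 6 - e 2 - 3 * e 3" by (simp add: d_def)
  have "has_qlogderiv (\<lambda>q. 1 + (- 8) * hauptmodul6 q) ((- 8) * w * d / (1 + (- 8) * w)) q"
    unfolding w_def d_def by (rule has_qlogderiv_affine[OF L(2)]) (use nz in \<open>simp add: w_def\<close>)
  then have "has_qlogderiv (\<lambda>q. 1 - 8 * hauptmodul6 q) ((- 8) * w * d / (1 - 8 * w)) q" by simp
  from has_qlogderiv_unique[OF L(3) this q(2)]
  have r1: "(2 * e 1 + e 6 - 2 * e 3 - e 2) * (1 - 8 * w) = (- 8) * w * d * 6"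
    by (subst (asm) frac_eq_eq) (use nz(3) in simp_all)
  have "has_qlogderiv (\<lambda>q. 1 + 1 * hauptmodul6 q) (1 * w * d / (1 + 1 * w)) q"
    unfolding w_def d_def by (rule has_qlogderiv_affine[OF L(2)]) (use nz in \<open>simp add: w_def\<close>)
  then have "has_qlogderiv (\<lambda>q. 1 + hauptmodul6 q) (w * d / (1 + w)) q" by simp
  from has_qlogderiv_unique[OF L(4) this q(2)]
  have r2: "(5 * e 2 + e 6 - e 1 - 5 * e 3) * (1 + w) = w * d * 24"
    by (subst (asm) frac_eq_eq) (use nz(4) in simp_all)
  show "(e 3 - e 1) * ((1 - 8 * w) * (1 + w)) = 2 * (1 + 4 * w)\<^sup>2 * d"
    "(e 2 - e 1) * ((1 - 8 * w) * (1 + w)) = (1 + 20 * w - 8 * w\<^sup>2) * d"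
    "(e 6 - e 2) * ((1 - 8 * w) * (1 + w)) = 4 * (1 - 2 * w)\<^sup>2 * d"
    using d8 r1 r2 by algebra+
qed

text \<open>The function \<open>a(q)\<close>, written through eta quotients so that it is visibly holomorphic on the whole
  disc, including \<open>q = 0\<close>.\<close>

definition level3_a :: "complex \<Rightarrow> complex" where
  "level3_a q = level6_form q * (1 + 4 * hauptmodul6 q)"

lemma level3_a_square:
  assumes q: "norm q < 1" "q \<noteq> 0"
  shows "level3_a (q\<^sup>2) = level6_form q * (1 - 2 * hauptmodul6 q)"
  using level6_relations(3)[of "q\<^sup>2"] level6_relations(4)[OF q] q norm_power_less_one[OF q(1), of 2]
  by (simp add: level3_a_def)

lemma level3_a_holomorphic: "level3_a holomorphic_on ball 0 1"
  unfolding level3_a_def by (intro holomorphic_intros level6_holomorphic)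

lemma isCont_0_if_holomorphic:
  "f holomorphic_on ball 0 1 \<Longrightarrow> isCont f (0 :: complex)"
  using holomorphic_on_imp_continuous_on continuous_on_interior[of "ball 0 1" f 0] by auto

lemma holomorphic_compose_power:
  assumes "f holomorphic_on ball 0 1" "k > 0"
  shows "(\<lambda>q. f (q ^ k :: complex)) holomorphic_on ball 0 1"
  by (rule holomorphic_on_compose_gen[OF _ assms(1), of "\<lambda>q. q ^ k", unfolded o_def])
     (use norm_power_less_one assms(2) in \<open>auto intro!: holomorphic_intros\<close>)

text \<open>By the linear relations, \<open>(3E\<^sub>2(q\<^sup>3) - E\<^sub>2(q)) / a(q)\<^sup>2\<close> takes the same value at \<open>q\<close> and \<open>q\<^sup>2\<close>; the
  functional equation, in a form free of denominators, then shows that it equals its value \<open>2\<close> at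
  \<open>q = 0\<close>.\<close>

lemma eisen2_level3:
  assumes q: "norm q < 1"
  shows "3 * eisen2 (q ^ 3) - eisen2 q = 2 * level3_a q ^ 2"
proof -
  define N where "N = (\<lambda>q. 3 * eisen2 (q ^ 3) - eisen2 q - 2 * level3_a q ^ 2)"
  define A where "A = (\<lambda>q. (level6_form q * (1 - 2 * hauptmodul6 q))\<^sup>2)"
  define M where "M = (\<lambda>q. (level3_a q)\<^sup>2)"
  have "N q = 0"
  proof (rule square_functional_equation[of N A M])
    show "N holomorphic_on ball 0 1" unfolding N_def
      by (intro holomorphic_intros eisen_holomorphic level3_a_holomorphic holomorphic_compose_power) auto
    show "isCont A 0" unfolding A_def
      by (rule isCont_0_if_holomorphic) (intro holomorphic_intros level6_holomorphic)
    show "isCont M 0" unfolding M_def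
      by (rule isCont_0_if_holomorphic) (intro holomorphic_intros level3_a_holomorphic)
    show "A 0 \<noteq> 0" "N 0 = 0" by (simp_all add: A_def N_def level3_a_def)
    show "N p * A p = N (p\<^sup>2) * M p" if p: "norm p < 1" "p \<noteq> 0" for p
    proof -
      define w where "w = hauptmodul6 p"
      define g where "g = level6_form p"
      define e where "e = (\<lambda>d. scaled_eisen2 d p)"
      have e': "e n = scaled_eisen2 n p" for n by (simp add: e_def)
      note r = eisen2_linear_relations[OF p, folded w_def e']
      have E: "(1 - 8 * w) * (1 + w) \<noteq> 0" using level6_nonzero[OF p] by (simp add: w_def)
      have "((e 3 - e 1) * (2 * (1 - 2 * w)\<^sup>2)) * ((1 - 8 * w) * (1 + w)) = ((e 6 - e 2) * (1 + 4 * w)\<^sup>2) * ((1 - 8 * w) * (1 + w))"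
        using r(1,3) by algebra
      then have rel: "(e 3 - e 1) * (2 * (1 - 2 * w)\<^sup>2) = (e 6 - e 2) * (1 + 4 * w)\<^sup>2"
        using E by (simp only: mult_cancel_right) simp
      have N1: "N p = e 3 - e 1 - 2 * (g * (1 + 4 * w))\<^sup>2"
        by (simp add: N_def e_def scaled_eisen2_def level3_a_def g_def w_def)
      have "2 * N (p\<^sup>2) = e 6 - e 2 - 4 * (g * (1 - 2 * w))\<^sup>2"
        by (simp add: N_def e_def scaled_eisen2_def level3_a_square[OF p] g_def w_def flip: power_mult)
      moreover have "A p = (g * (1 - 2 * w))\<^sup>2" "M p = (g * (1 + 4 * w))\<^sup>2"
        by (simp_all add: A_def M_def level3_a_def g_def w_def)
      ultimately have "2 * (N p * A p) = 2 * (N (p\<^sup>2) * M p)" using rel N1 by algebra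
      then show ?thesis by simp
    qed
  qed (rule q)
  then show ?thesis by (simp add: N_def)
qed

text \<open>The last equation identifies the logarithmic derivative \<open>d\<close> of the Hauptmodul. Dividing the
  relation at level 3 by \<open>(1 + 4w)\<^sup>2\<close> finds \<open>d\<close> unless \<open>1 + 4w = 0\<close>, and then the same relation at \<open>q\<^sup>2\<close>, where
  the factor is \<open>(1 - 2w)\<^sup>2\<close>, serves instead.\<close>

lemma eisen2_level6:
  assumes q: "norm q < 1" "q \<noteq> 0"
  defines "w \<equiv> hauptmodul6 q" and "g \<equiv> level6_form q" and "e \<equiv> (\<lambda>d. scaled_eisen2 d q)"
  shows "e 3 - e 1 = 2 * g\<^sup>2 * (1 + 4 * w)\<^sup>2"
    and "e 2 - e 1 = g\<^sup>2 * (1 + 20 * w - 8 * w\<^sup>2)"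
    and "e 6 - e 2 = 4 * g\<^sup>2 * (1 - 2 * w)\<^sup>2"
    and "e 1 + 3 * e 6 - e 2 - 3 * e 3 = 8 * (g\<^sup>2 * (1 - 8 * w) * (1 + w))"
proof -
  define d where "d = (e 1 + 3 * e 6 - e 2 - 3 * e 3) / 8"
  have e': "e n = scaled_eisen2 n q" for n by (simp add: e_def)
  note r = eisen2_linear_relations[OF q, folded w_def e', folded d_def]
  have E: "(1 - 8 * w) * (1 + w) \<noteq> 0" using level6_nonzero[OF q] by (simp add: w_def)
  have q2: "norm (q\<^sup>2) < 1" using norm_power_less_one[OF q(1)] by simp
  show 1: "e 3 - e 1 = 2 * g\<^sup>2 * (1 + 4 * w)\<^sup>2"
    using eisen2_level3[OF q(1)]
    by (simp add: e_def scaled_eisen2_def level3_a_def g_def w_def power_mult_distrib)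
  have "e 6 - e 2 = 2 * (3 * eisen2 ((q\<^sup>2) ^ 3) - eisen2 (q\<^sup>2))"
    by (simp add: e_def scaled_eisen2_def flip: power_mult)
  then show 2: "e 6 - e 2 = 4 * g\<^sup>2 * (1 - 2 * w)\<^sup>2"
    unfolding eisen2_level3[OF q2] level3_a_square[OF q]
    by (simp add: g_def w_def power_mult_distrib)
  have "(1 + 4 * w)\<^sup>2 * d = (1 + 4 * w)\<^sup>2 * (g\<^sup>2 * (1 - 8 * w) * (1 + w))"
    using r(1) 1 by algebra
  moreover have "(1 - 2 * w)\<^sup>2 * d = (1 - 2 * w)\<^sup>2 * (g\<^sup>2 * (1 - 8 * w) * (1 + w))"
    using r(3) 2 by algebra
  moreover have "1 + 4 * w \<noteq> 0 \<or> 1 - 2 * w \<noteq> 0"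
  proof (rule ccontr)
    assume "\<not> ?thesis"
    then have "(1 + 4 * w) + 2 * (1 - 2 * w) = 0" by simp
    then show False by simp
  qed
  ultimately have d: "d = g\<^sup>2 * (1 - 8 * w) * (1 + w)" by auto
  then show "e 1 + 3 * e 6 - e 2 - 3 * e 3 = 8 * (g\<^sup>2 * (1 - 8 * w) * (1 + w))"
    by (simp add: d_def field_simps)
  have "(e 2 - e 1) * ((1 - 8 * w) * (1 + w)) = (g\<^sup>2 * (1 + 20 * w - 8 * w\<^sup>2)) * ((1 - 8 * w) * (1 + w))"
    using r(2) d by algebra
  then show "e 2 - e 1 = g\<^sup>2 * (1 + 20 * w - 8 * w\<^sup>2)"
    using E by (simp only: mult_cancel_right) simp
qed

section \<open>Eisenstein series of weight four at level six\<close>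

lemma scaled_eisen2_derivative:
  assumes q: "norm q < 1" "q \<noteq> 0" and "k > 0"
  shows "(scaled_eisen2 k has_field_derivative (scaled_eisen2 k q ^ 2 - of_nat k ^ 2 * eisen4 (q ^ k)) / 12 / q) (at q)"
proof -
  have "norm (q ^ k) < 1" "q ^ k \<noteq> 0" using norm_power_less_one assms by auto
  from qderiv_compose_power[OF eisen2_derivative[OF this] q(2) assms(3)]
  have "((\<lambda>q. eisen2 (q ^ k)) has_field_derivative of_nat k * ((eisen2 (q ^ k) ^ 2 - eisen4 (q ^ k)) / 12) / q) (at q)" .
  from DERIV_cmult[OF this, of "of_nat k"] show ?thesis
    unfolding scaled_eisen2_def by (simp add: power2_eq_square algebra_simps)
qed

lemma punctured_disc_derivative_eq:
  assumes q: "norm q < 1" "q \<noteq> 0"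
    and eq: "\<And>p. norm p < 1 \<Longrightarrow> p \<noteq> 0 \<Longrightarrow> f p = h p"
    and "(f has_field_derivative a / q) (at q)" "(h has_field_derivative b / q) (at (q :: complex))"
  shows "a = b"
proof -
  have "eventually (\<lambda>p. p \<in> ball 0 1 - {0}) (nhds q)"
    by (rule eventually_nhds_in_open) (use q in auto)
  then have "eventually (\<lambda>p. f p = h p) (nhds q)" by eventually_elim (use eq in auto)
  then have "(h has_field_derivative a / q) (at q)"
    using DERIV_cong_ev[OF refl _ refl, of f h q "a / q"] assms(4) by simp
  then have "a / q = b / q" using assms(5) DERIV_unique by blast
  then show ?thesis using q by simp
qed

text \<open>Differentiate the formulas for \<open>2E\<^sub>2(q\<^sup>2) - E\<^sub>2(q)\<close> and \<open>3E\<^sub>2(q\<^sup>3) - E\<^sub>2(q)\<close>. Ramanujan's equation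
  brings in \<open>E\<^sub>4\<close> on the left; on the right the logarithmic derivatives of \<open>g\<close> and \<open>w\<close> are again given by the
  \<open>E\<^sub>2(q\<^sup>d)\<close>, and all terms containing \<open>E\<^sub>2(q)\<close> itself cancel.\<close>

lemma eisen4_differences:
  assumes q: "norm q < 1" "q \<noteq> 0"
  defines "w \<equiv> hauptmodul6 q" and "g \<equiv> level6_form q"
  shows "eisen4 q - 4 * eisen4 (q\<^sup>2) =
      g ^ 4 * ((1 + 4 * w) * ((1 + 4 * w) ^ 3 + 216 * w) - 4 * ((1 - 2 * w) * ((1 - 2 * w) ^ 3 + 216 * w\<^sup>2)))"
    and "eisen4 q - 9 * eisen4 (q ^ 3) =
      g ^ 4 * ((1 + 4 * w) * ((1 + 4 * w) ^ 3 + 216 * w) - 9 * ((1 + 4 * w) * ((1 + 4 * w) ^ 3 - 24 * w)))"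
proof -
  define e where "e = (\<lambda>d. scaled_eisen2 d q)"
  define d where "d = (e 1 + 3 * e 6 - e 2 - 3 * e 3) / 8"
  define k where "k = (6 * e 3 + e 2 - 2 * e 1 - 3 * e 6) / 24"
  have e': "e n = scaled_eisen2 n q" for n by (simp add: e_def)
  note r = eisen2_level6[OF q, folded w_def g_def e']
  have d: "d = g\<^sup>2 * (1 - 8 * w) * (1 + w)" using r(4) by (simp add: d_def)
  have dg: "(level6_form has_field_derivative g * k / q) (at q)"
    and dw: "(hauptmodul6 has_field_derivative w * d / q) (at q)"
    using has_qlogderiv_level6(1,2)[OF q] by (simp_all add: has_qlogderiv_def g_def w_def k_def d_def e_def)
  have k24: "24 * k = 6 * e 3 + e 2 - 2 * e 1 - 3 * e 6" by (simp add: k_def)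
  have de: "(scaled_eisen2 n has_field_derivative (e n ^ 2 - of_nat n ^ 2 * eisen4 (q ^ n)) / 12 / q) (at q)" if "n > 0" for n
    unfolding e_def by (rule scaled_eisen2_derivative[OF q that])
  have "((e 2)\<^sup>2 - 4 * eisen4 (q\<^sup>2) - ((e 1)\<^sup>2 - eisen4 q)) / 12 =
     2 * g\<^sup>2 * k * (1 + 20 * w - 8 * w\<^sup>2) + g\<^sup>2 * (20 - 16 * w) * (w * d)"
  proof (rule punctured_disc_derivative_eq[OF q])
    show "scaled_eisen2 2 p - scaled_eisen2 1 p = (level6_form p)\<^sup>2 * (1 + 20 * hauptmodul6 p - 8 * (hauptmodul6 p)\<^sup>2)"
      if "norm p < 1" "p \<noteq> 0" for p
      using eisen2_level6(2)[OF that] .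
    show "((\<lambda>p. scaled_eisen2 2 p - scaled_eisen2 1 p) has_field_derivative
        ((e 2)\<^sup>2 - 4 * eisen4 (q\<^sup>2) - ((e 1)\<^sup>2 - eisen4 q)) / 12 / q) (at q)"
      using DERIV_diff[OF de[of 2] de[of 1]] by (simp add: diff_divide_distrib)
    show "((\<lambda>p. (level6_form p)\<^sup>2 * (1 + 20 * hauptmodul6 p - 8 * (hauptmodul6 p)\<^sup>2)) has_field_derivative
        (2 * g\<^sup>2 * k * (1 + 20 * w - 8 * w\<^sup>2) + g\<^sup>2 * (20 - 16 * w) * (w * d)) / q) (at q)"
      by (rule derivative_eq_intros dg dw refl)+
         (simp add: g_def w_def power2_eq_square field_simps q)
  qed
  then have "(e 2)\<^sup>2 - 4 * eisen4 (q\<^sup>2) - ((e 1)\<^sup>2 - eisen4 q) =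
     12 * (2 * g\<^sup>2 * k * (1 + 20 * w - 8 * w\<^sup>2) + g\<^sup>2 * (20 - 16 * w) * (w * d))"
    by (simp add: field_simps)
  then have "eisen4 q - 4 * eisen4 (q\<^sup>2) = (e 1)\<^sup>2 - (e 2)\<^sup>2 + g\<^sup>2 * (24 * k) * (1 + 20 * w - 8 * w\<^sup>2) + 12 * g\<^sup>2 * (20 - 16 * w) * (w * d)"
    by algebra
  then show "eisen4 q - 4 * eisen4 (q\<^sup>2) =
      g ^ 4 * ((1 + 4 * w) * ((1 + 4 * w) ^ 3 + 216 * w) - 4 * ((1 - 2 * w) * ((1 - 2 * w) ^ 3 + 216 * w\<^sup>2)))"
    unfolding k24 d using r(1,2,3) by algebra
  have "((e 3)\<^sup>2 - 9 * eisen4 (q ^ 3) - ((e 1)\<^sup>2 - eisen4 q)) / 12 =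
     4 * g\<^sup>2 * k * (1 + 4 * w)\<^sup>2 + 16 * g\<^sup>2 * (1 + 4 * w) * (w * d)"
  proof (rule punctured_disc_derivative_eq[OF q])
    show "scaled_eisen2 3 p - scaled_eisen2 1 p = 2 * (level6_form p)\<^sup>2 * (1 + 4 * hauptmodul6 p)\<^sup>2"
      if "norm p < 1" "p \<noteq> 0" for p
      using eisen2_level6(1)[OF that] .
    show "((\<lambda>p. scaled_eisen2 3 p - scaled_eisen2 1 p) has_field_derivative
        ((e 3)\<^sup>2 - 9 * eisen4 (q ^ 3) - ((e 1)\<^sup>2 - eisen4 q)) / 12 / q) (at q)"
      using DERIV_diff[OF de[of 3] de[of 1]] by (simp add: diff_divide_distrib)
    show "((\<lambda>p. 2 * (level6_form p)\<^sup>2 * (1 + 4 * hauptmodul6 p)\<^sup>2) has_field_derivative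
        (4 * g\<^sup>2 * k * (1 + 4 * w)\<^sup>2 + 16 * g\<^sup>2 * (1 + 4 * w) * (w * d)) / q) (at q)"
      by (rule derivative_eq_intros dg dw refl)+
         (simp add: g_def w_def power2_eq_square field_simps q)
  qed
  then have "(e 3)\<^sup>2 - 9 * eisen4 (q ^ 3) - ((e 1)\<^sup>2 - eisen4 q) =
     12 * (4 * g\<^sup>2 * k * (1 + 4 * w)\<^sup>2 + 16 * g\<^sup>2 * (1 + 4 * w) * (w * d))"
    by (simp add: field_simps)
  then have "eisen4 q - 9 * eisen4 (q ^ 3) = (e 1)\<^sup>2 - (e 3)\<^sup>2 + 2 * g\<^sup>2 * (24 * k) * (1 + 4 * w)\<^sup>2 + 192 * g\<^sup>2 * (1 + 4 * w) * (w * d)"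
    by algebra
  then show "eisen4 q - 9 * eisen4 (q ^ 3) =
      g ^ 4 * ((1 + 4 * w) * ((1 + 4 * w) ^ 3 + 216 * w) - 9 * ((1 + 4 * w) * ((1 + 4 * w) ^ 3 - 24 * w)))"
    unfolding k24 d using r(1,2,3) by algebra
qed

text \<open>The cube of the Borwein function \<open>b(q) = \<eta>(\<tau>)\<^sup>3/\<eta>(3\<tau>)\<close>.\<close>

definition level3_b3 :: "complex \<Rightarrow> complex" where
  "level3_b3 q = (euler q ^ 3 / euler (q ^ 3)) ^ 3"

lemma level3_b3_level6:
  assumes q: "norm q < 1" "q \<noteq> 0"
  defines "w \<equiv> hauptmodul6 q" and "g \<equiv> level6_form q"
  shows "level3_b3 q = g ^ 3 * ((1 - 8 * w)\<^sup>2 * (1 + w))"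
    and "level3_b3 (q\<^sup>2) = g ^ 3 * ((1 - 8 * w) * (1 + w)\<^sup>2)"
proof -
  have nz: "euler q \<noteq> 0" "euler (q\<^sup>2) \<noteq> 0" "euler (q ^ 3) \<noteq> 0" "euler (q ^ 6) \<noteq> 0"
    using euler_nonzero[OF q(1)] euler_power_nonzero[OF q(1)] by simp_all
  note r = level6_relations(1,2)[OF q, folded w_def]
  show "level3_b3 q = g ^ 3 * ((1 - 8 * w)\<^sup>2 * (1 + w))"
    unfolding level3_b3_def g_def level6_form_def r power_divide times_divide_times_eq
    by (subst frac_eq_eq) (use nz in simp, use nz in simp, algebra)
  have "level3_b3 (q\<^sup>2) = (euler (q\<^sup>2) ^ 3 / euler (q ^ 6)) ^ 3"
    by (simp add: level3_b3_def flip: power_mult)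
  also have "\<dots> = g ^ 3 * ((1 - 8 * w) * (1 + w)\<^sup>2)"
    unfolding g_def level6_form_def r power_divide times_divide_times_eq
    by (subst frac_eq_eq) (use nz in simp, use nz in simp, algebra)
  finally show "level3_b3 (q\<^sup>2) = g ^ 3 * ((1 - 8 * w) * (1 + w)\<^sup>2)" .
qed

lemma level3_b3_holomorphic: "level3_b3 holomorphic_on ball 0 1"
  unfolding level3_b3_def
  by (intro holomorphic_on_divide holomorphic_on_power euler_holomorphic holomorphic_compose_power)
     (use euler_power_nonzero in auto)

text \<open>Let \<open>X\<close> be the right side. In terms of \<open>g\<close> and \<open>w\<close>, \<open>X(q) - 4X(q\<^sup>2)\<close> is the polynomial found for
  \<open>E\<^sub>4(q) - 4E\<^sub>4(q\<^sup>2)\<close>, so \<open>N = E\<^sub>4 - X\<close> satisfies \<open>N(q) = 4N(q\<^sup>2)\<close> and vanishes at \<open>0\<close>.\<close>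

theorem eisen4_level3:
  assumes q: "norm q < 1"
  shows "eisen4 q = level3_a q * (9 * level3_a q ^ 3 - 8 * level3_b3 q)"
proof -
  define N where "N = (\<lambda>q. eisen4 q - level3_a q * (9 * level3_a q ^ 3 - 8 * level3_b3 q))"
  have "N q = 0"
  proof (rule square_functional_equation[of N "\<lambda>_. 1" "\<lambda>_. 4"])
    show "N holomorphic_on ball 0 1" unfolding N_def
      by (intro holomorphic_intros eisen_holomorphic level3_a_holomorphic level3_b3_holomorphic)
    show "N 0 = 0" by (simp add: N_def level3_a_def level3_b3_def)
    show "N p * 1 = N (p\<^sup>2) * 4" if p: "norm p < 1" "p \<noteq> 0" for p
      unfolding N_def level3_a_square[OF p] level3_b3_level6[OF p]
      using eisen4_differences(1)[OF p] unfolding level3_a_def by algebra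
  qed (use q in auto)
  then show ?thesis by (simp add: N_def)
qed

lemma eisen4_level3_cube:
  assumes q: "norm q < 1" "q \<noteq> 0"
  shows "9 * eisen4 (q ^ 3) = level3_a q * (level3_a q ^ 3 + 8 * level3_b3 q)"
  using eisen4_differences(2)[OF q] eisen4_level3[OF q(1)] level3_b3_level6(1)[OF q]
  unfolding level3_a_def by algebra

theorem eisen4_level6:
  assumes q: "norm q < 1" "q \<noteq> 0"
  defines "w \<equiv> hauptmodul6 q" and "g \<equiv> level6_form q"
  shows "eisen4 q = g ^ 4 * ((1 + 4 * w) * ((1 + 4 * w) ^ 3 + 216 * w))"
    and "eisen4 (q\<^sup>2) = g ^ 4 * ((1 - 2 * w) * ((1 - 2 * w) ^ 3 + 216 * w\<^sup>2))"
    and "eisen4 (q ^ 3) = g ^ 4 * ((1 + 4 * w) * (1 - 12 * w + 48 * w\<^sup>2 + 64 * w ^ 3))"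
    and "eisen4 (q ^ 6) = g ^ 4 * ((1 - 2 * w) * (1 - 6 * w - 12 * w\<^sup>2 - 8 * w ^ 3))"
proof -
  have q2: "norm (q\<^sup>2) < 1" "q\<^sup>2 \<noteq> 0" using norm_power_less_one[OF q(1)] q by auto
  note b = level3_b3_level6[OF q, folded w_def g_def]
  have a: "level3_a q = g * (1 + 4 * w)" "level3_a (q\<^sup>2) = g * (1 - 2 * w)"
    using level3_a_square[OF q] by (simp_all add: level3_a_def g_def w_def)
  show "eisen4 q = g ^ 4 * ((1 + 4 * w) * ((1 + 4 * w) ^ 3 + 216 * w))"
    unfolding eisen4_level3[OF q(1)] a b by algebra
  show "eisen4 (q\<^sup>2) = g ^ 4 * ((1 - 2 * w) * ((1 - 2 * w) ^ 3 + 216 * w\<^sup>2))"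
    unfolding eisen4_level3[OF q2(1)] a b by algebra
  have nine: "x = y" if "9 * x = 9 * y" for x y :: complex using that by simp
  show "eisen4 (q ^ 3) = g ^ 4 * ((1 + 4 * w) * (1 - 12 * w + 48 * w\<^sup>2 + 64 * w ^ 3))"
    by (rule nine) (unfold eisen4_level3_cube[OF q] a b, algebra)
  have "9 * eisen4 (q ^ 6) = level3_a (q\<^sup>2) * (level3_a (q\<^sup>2) ^ 3 + 8 * level3_b3 (q\<^sup>2))"
    using eisen4_level3_cube[OF q2] by (simp flip: power_mult)
  also have "\<dots> = 9 * (g ^ 4 * ((1 - 2 * w) * (1 - 6 * w - 12 * w\<^sup>2 - 8 * w ^ 3)))"
    unfolding a b by algebra
  finally show "eisen4 (q ^ 6) = g ^ 4 * ((1 - 2 * w) * (1 - 6 * w - 12 * w\<^sup>2 - 8 * w ^ 3))" by (rule nine)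
qed

section \<open>The discriminant and the modular invariant\<close>

lemma discriminant_level6:
  assumes q: "norm q < 1" "q \<noteq> 0"
  defines "w \<equiv> hauptmodul6 q" and "g \<equiv> level6_form q"
  shows "q * euler q ^ 24 = g ^ 12 * (w * ((1 - 8 * w) ^ 6 * (1 + w) ^ 3))"
    and "q\<^sup>2 * euler (q\<^sup>2) ^ 24 = g ^ 12 * (w\<^sup>2 * ((1 - 8 * w) ^ 3 * (1 + w) ^ 6))"
    and "q ^ 3 * euler (q ^ 3) ^ 24 = g ^ 12 * (w ^ 3 * ((1 - 8 * w)\<^sup>2 * (1 + w)))"
    and "q ^ 6 * euler (q ^ 6) ^ 24 = g ^ 12 * (w ^ 6 * ((1 - 8 * w) * (1 + w)\<^sup>2))"
proof -
  define P1 P2 P3 P6 where P: "P1 = euler q" "P2 = euler (q\<^sup>2)" "P3 = euler (q ^ 3)" "P6 = euler (q ^ 6)"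
  have nz: "P1 \<noteq> 0" "P2 \<noteq> 0" "P3 \<noteq> 0" "P6 \<noteq> 0"
    unfolding P using euler_nonzero[OF q(1)] euler_power_nonzero[OF q(1)] by simp_all
  note r = level6_relations(1,2)[OF q, folded w_def P]
  have g: "g = P3 ^ 6 * P2 / (P1\<^sup>2 * P6 ^ 3)" by (simp add: g_def level6_form_def P)
  have w: "w = q * (P1 ^ 3 * P6 ^ 9) / (P2 ^ 3 * P3 ^ 9)"
    by (simp add: w_def hauptmodul6_def P power_divide power_mult_distrib flip: power_mult)
  have eqI: "x = y / z" if "z \<noteq> 0" "x * z = y" for x y z :: complex using that by (simp add: field_simps)
  show "q * euler q ^ 24 = g ^ 12 * (w * ((1 - 8 * w) ^ 6 * (1 + w) ^ 3))"
    unfolding P[symmetric] r g unfolding w power_divide times_divide_times_eq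
    by (rule eqI) (use nz in simp, algebra)
  show "q\<^sup>2 * euler (q\<^sup>2) ^ 24 = g ^ 12 * (w\<^sup>2 * ((1 - 8 * w) ^ 3 * (1 + w) ^ 6))"
    unfolding P[symmetric] r g unfolding w power_divide times_divide_times_eq
    by (rule eqI) (use nz in simp, algebra)
  show "q ^ 3 * euler (q ^ 3) ^ 24 = g ^ 12 * (w ^ 3 * ((1 - 8 * w)\<^sup>2 * (1 + w)))"
    unfolding P[symmetric] r g unfolding w power_divide times_divide_times_eq
    by (rule eqI) (use nz in simp, algebra)
  show "q ^ 6 * euler (q ^ 6) ^ 24 = g ^ 12 * (w ^ 6 * ((1 - 8 * w) * (1 + w)\<^sup>2))"
    unfolding P[symmetric] r g unfolding w power_divide times_divide_times_eq
    by (rule eqI) (use nz in simp, algebra)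
qed

lemma qpow_of_nat_mult: "qpow (of_nat k * r) \<tau> = qpow r \<tau> ^ k"
  unfolding qpow_def by (simp add: mult_ac of_rat_mult flip: exp_of_nat_mult)

lemma qpow_mult_of_nat: "qpow r (of_nat k * \<tau>) = qpow r \<tau> ^ k"
  unfolding qpow_def by (simp add: mult_ac flip: exp_of_nat_mult)

lemma norm_nome_less_one:
  assumes "Im \<tau> > 0"
  shows "norm (nome \<tau>) < 1"
  using assms by (simp add: qpow_def)

lemma dedekind_eta_eq_euler: "dedekind_eta \<tau> = qpow (1 / 24) \<tau> * euler (nome \<tau>)"
  by (simp add: dedekind_eta_def euler_def q_pochhammer_def)

text \<open>\<open>j = E\<^sub>4\<^sup>3/\<Delta>\<close> with \<open>\<Delta> = \<eta>\<^bsup>24\<^esup> = q \<Prod> (1 - q\<^sup>n)\<^bsup>24\<^esup>\<close>.\<close>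

lemma modular_j_eq:
  assumes "Im \<tau> > 0"
  shows "modular_j \<tau> = eisen4 (nome \<tau>) ^ 3 / (nome \<tau> * euler (nome \<tau>) ^ 24)"
proof -
  have "qpow (1 / 24) \<tau> ^ 24 = nome \<tau>"
    using qpow_of_nat_mult[of 24 "1 / 24" \<tau>] by simp
  then have "dedekind_eta \<tau> ^ 24 = nome \<tau> * euler (nome \<tau>) ^ 24"
    by (simp add: dedekind_eta_eq_euler power_mult_distrib)
  then show ?thesis
    unfolding modular_j_def eisen4_def lambert_eq_Suc[OF norm_nome_less_one[OF assms]]
    by (simp add: power_int_minus divide_inverse mult.commute)
qed

lemma eta_quotient_u_cube:
  assumes "Im \<tau> > 0"
  shows "eta_quotient_u \<tau> ^ 3 = hauptmodul6 (nome (3 * \<tau>))"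
proof -
  \<comment> \<open>All fractional powers of the nome are powers of \<open>x\<close>, so the quotient needs no choice of roots.\<close>
  define x where "x = qpow (1 / 24) (3 * \<tau>)"
  define q where "q = nome (3 * \<tau>)"
  have "x \<noteq> 0" by (simp add: x_def qpow_def)
  have xq: "x ^ 24 = q"
    using qpow_of_nat_mult[of 24 "1 / 24" "3 * \<tau>"] by (simp add: x_def q_def)
  have eta: "dedekind_eta (of_nat k * (3 * \<tau>)) = x ^ k * euler (q ^ k)" for k
    unfolding dedekind_eta_eq_euler qpow_mult_of_nat x_def q_def ..
  have "eta_quotient_u \<tau> = (x * euler q) * (x ^ 6 * euler (q ^ 6)) ^ 3 / ((x\<^sup>2 * euler (q\<^sup>2)) * (x ^ 3 * euler (q ^ 3)) ^ 3)"
    using eta[of 1] eta[of 2] eta[of 3] eta[of 6] by (simp add: eta_quotient_u_def)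
  also have "\<dots> = x ^ 8 * (euler q * euler (q ^ 6) ^ 3 / (euler (q\<^sup>2) * euler (q ^ 3) ^ 3))"
  proof -
    have num: "(x * euler q) * (x ^ 6 * euler (q ^ 6)) ^ 3 = x ^ 11 * (x ^ 8 * (euler q * euler (q ^ 6) ^ 3))"
      by algebra
    have den: "(x\<^sup>2 * euler (q\<^sup>2)) * (x ^ 3 * euler (q ^ 3)) ^ 3 = x ^ 11 * (euler (q\<^sup>2) * euler (q ^ 3) ^ 3)"
      by algebra
    show ?thesis unfolding num den using \<open>x \<noteq> 0\<close> by (subst mult_divide_mult_cancel_left) simp_all
  qed
  finally have "eta_quotient_u \<tau> ^ 3 = (x ^ 8) ^ 3 * (euler q * euler (q ^ 6) ^ 3 / (euler (q\<^sup>2) * euler (q ^ 3) ^ 3)) ^ 3"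
    by (simp only: power_mult_distrib)
  also have "(x ^ 8) ^ 3 = q" using xq by (simp flip: power_mult)
  finally show ?thesis by (simp add: hauptmodul6_def q_def)
qed

theorem theorem6p2:
  fixes \<tau> u :: complex
  assumes "Im \<tau> > 0" and "u = eta_quotient_u \<tau>"
  shows "modular_j (3 * \<tau>) =
           ((1 + 4 * u ^ 3) ^ 3 * (1 + 6 * u + 4 * u ^ 3) ^ 3 *
            (1 - 6 * u + 36 * u ^ 2 + 8 * u ^ 3 - 24 * u ^ 4 + 16 * u ^ 6) ^ 3) /
           (u ^ 3 * (1 - 2 * u) ^ 6 * (1 + u) ^ 3 * (1 - u + u ^ 2) ^ 3 * (1 + 2 * u + 4 * u ^ 2) ^ 6) \<and>
         modular_j (6 * \<tau>) =
           ((1 - 2 * u ^ 3) ^ 3 * (1 + 6 * u ^ 2 - 2 * u ^ 3) ^ 3 *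
            (1 - 6 * u ^ 2 - 4 * u ^ 3 + 36 * u ^ 4 + 12 * u ^ 5 + 4 * u ^ 6) ^ 3) /
           (u ^ 6 * (1 - 2 * u) ^ 3 * (1 + u) ^ 6 * (1 - u + u ^ 2) ^ 6 * (1 + 2 * u + 4 * u ^ 2) ^ 3) \<and>
         modular_j (9 * \<tau>) =
           ((1 + 4 * u ^ 3) ^ 3 * (1 - 12 * u ^ 3 + 48 * u ^ 6 + 64 * u ^ 9) ^ 3) /
           (u ^ 9 * (1 - 2 * u) ^ 2 * (1 + u) * (1 - u + u ^ 2) * (1 + 2 * u + 4 * u ^ 2) ^ 2) \<and>
         modular_j (18 * \<tau>) =
           ((1 - 2 * u ^ 3) ^ 3 * (1 - 6 * u ^ 3 - 12 * u ^ 6 - 8 * u ^ 9) ^ 3) /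
           (u ^ 18 * (1 - 2 * u) * (1 + u) ^ 2 * (1 - u + u ^ 2) ^ 2 * (1 + 2 * u + 4 * u ^ 2))"
proof -
  define q where "q = nome (3 * \<tau>)"
  define w where "w = hauptmodul6 q"
  define g where "g = level6_form q"
  have tau: "Im (of_nat k * (3 * \<tau>)) > 0" if "k > 0" for k
    using assms(1) that by simp
  have q: "norm q < 1" "q \<noteq> 0"
    using norm_nome_less_one[of "3 * \<tau>"] assms(1) by (auto simp: q_def qpow_def)
  have w: "u ^ 3 = w"
    using eta_quotient_u_cube[OF assms(1)] assms(2) by (simp add: w_def q_def)
  have "g \<noteq> 0" using level6_nonzero[OF q] by (simp add: g_def)
  have j: "modular_j (of_nat k * (3 * \<tau>)) = F ^ 3 / G"
    if "k > 0" "eisen4 (q ^ k) = g ^ 4 * F" "q ^ k * euler (q ^ k) ^ 24 = g ^ 12 * G" for k F G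
  proof -
    have "modular_j (of_nat k * (3 * \<tau>)) = eisen4 (q ^ k) ^ 3 / (q ^ k * euler (q ^ k) ^ 24)"
      unfolding modular_j_eq[OF tau[OF that(1)]] qpow_mult_of_nat q_def ..
    also have "\<dots> = (g ^ 12 * F ^ 3) / (g ^ 12 * G)"
      unfolding that(2,3) by (simp add: power_mult_distrib flip: power_mult)
    also have "\<dots> = F ^ 3 / G" using \<open>g \<noteq> 0\<close> by simp
    finally show ?thesis .
  qed
  note E = eisen4_level6[OF q, folded w_def g_def]
  note D = discriminant_level6[OF q, folded w_def g_def]
  have j1: "modular_j (3 * \<tau>) = ((1 + 4 * w) * ((1 + 4 * w) ^ 3 + 216 * w)) ^ 3 / (w * ((1 - 8 * w) ^ 6 * (1 + w) ^ 3))"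
    using j[of 1] E(1) D(1) by simp
  have j2: "modular_j (6 * \<tau>) = ((1 - 2 * w) * ((1 - 2 * w) ^ 3 + 216 * w\<^sup>2)) ^ 3 / (w\<^sup>2 * ((1 - 8 * w) ^ 3 * (1 + w) ^ 6))"
    using j[of 2, OF _ E(2) D(2)] by simp
  have j3: "modular_j (9 * \<tau>) = ((1 + 4 * w) * (1 - 12 * w + 48 * w\<^sup>2 + 64 * w ^ 3)) ^ 3 / (w ^ 3 * ((1 - 8 * w)\<^sup>2 * (1 + w)))"
    using j[of 3, OF _ E(3) D(3)] by simp
  have j6: "modular_j (18 * \<tau>) = ((1 - 2 * w) * (1 - 6 * w - 12 * w\<^sup>2 - 8 * w ^ 3)) ^ 3 / (w ^ 6 * ((1 - 8 * w) * (1 + w)\<^sup>2))"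
    using j[of 6, OF _ E(4) D(4)] by simp
  have f: "1 - 8 * w = (1 - 2 * u) * (1 + 2 * u + 4 * u\<^sup>2)" "1 + w = (1 + u) * (1 - u + u\<^sup>2)"
    "(1 + 4 * w) ^ 3 + 216 * w = (1 + 6 * u + 4 * u ^ 3) * (1 - 6 * u + 36 * u ^ 2 + 8 * u ^ 3 - 24 * u ^ 4 + 16 * u ^ 6)"
    "(1 - 2 * w) ^ 3 + 216 * w\<^sup>2 = (1 + 6 * u ^ 2 - 2 * u ^ 3) * (1 - 6 * u ^ 2 - 4 * u ^ 3 + 36 * u ^ 4 + 12 * u ^ 5 + 4 * u ^ 6)"
    unfolding w[symmetric] by algebra+
  have wp: "w\<^sup>2 = u ^ 6" "w ^ 3 = u ^ 9" "w ^ 6 = u ^ 18"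
    by (simp_all flip: w power_mult)
  show ?thesis
    unfolding j1 j2 j3 j6 unfolding f unfolding wp unfolding w[symmetric]
    by (simp add: power_mult_distrib mult_ac flip: power_mult)
qed

end
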